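(* Suppose that $p(x)$ is Lipschitz continuous. Let $\Omega\subset\mathbb{R}^N$ be connected and let $0\le u\in C^1(\Omega)$ be such that $\Delta_{p(x)}u\le0$ in $\Omega$. Then either $u\equiv0$ in $\Omega$ or $u>0$ in $\Omega$.
   Context: $\Omega$ is an open set and the exponent $p:\Omega\to\mathbb{R}$ satisfies $1<p_1\le p(x)\le p_2<\infty$ in $\Omega$. $\Delta_{p(x)}u=\mathrm{div}(|\nabla u|^{p(x)-2}\nabla u)$, and $\Delta_{p(x)}u\le0$ is understood in the weak sense: $\int_\Omega|\nabla u|^{p(x)-2}\nabla u\cdot\nabla\phi\,dx\ge0$ for every nonnegative test function $\phi$ (e.g. $\phi\in C_0^\infty(\Omega)$). *)

theory Defs
  imports "HOL-Analysis.Analysis"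
begin

text \<open>The exponents \<open>p\<close> and functions \<open>u\<close> are total functions; only their values on the open
  set \<open>S\<close> in question are ever constrained or used.\<close>

definition partial_deriv :: "('a::euclidean_space \<Rightarrow> real) \<Rightarrow> 'a \<Rightarrow> 'a \<Rightarrow> real" where
  "partial_deriv f b x = frechet_derivative f (at x) b"

definition grad :: "('a::euclidean_space \<Rightarrow> real) \<Rightarrow> 'a \<Rightarrow> 'a" where
  "grad f x = (\<Sum>b\<in>Basis. partial_deriv f b x *\<^sub>R b)"

text \<open>\<open>f \<in> C\<^sup>k(S)\<close>, meant for open \<open>S\<close>: differentiability is taken at \<open>x\<close> in the whole space.\<close>

primrec C_on :: "nat \<Rightarrow> 'a::euclidean_space set \<Rightarrow> ('a \<Rightarrow> real) \<Rightarrow> bool" where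
  "C_on 0 S f \<longleftrightarrow> continuous_on S f"
| "C_on (Suc k) S f \<longleftrightarrow>
     (\<forall>x\<in>S. f differentiable (at x)) \<and> (\<forall>b\<in>Basis. C_on k S (partial_deriv f b))"

text \<open>\<open>C\<^sub>0\<^sup>\<infinity>(S)\<close>, its elements being extended by zero to the whole space.\<close>

definition test_functions :: "'a::euclidean_space set \<Rightarrow> ('a \<Rightarrow> real) set" where
  "test_functions S =
     {\<phi>. (\<forall>k. C_on k UNIV \<phi>) \<and> compact (closure {x. \<phi> x \<noteq> 0}) \<and> closure {x. \<phi> x \<noteq> 0} \<subseteq> S}"

text \<open>The vector field \<open>|\<nabla>u|\<^bsup>p(x)-2\<^esup>\<nabla>u\<close>. Where \<open>\<nabla>u\<close> vanishes it is zero, as it should be for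
  \<open>p(x) > 1\<close>, because of the factor \<open>\<nabla>u\<close>; the value of \<open>0 powr (p x - 2)\<close> plays no role.\<close>

definition p_flux :: "('a::euclidean_space \<Rightarrow> real) \<Rightarrow> ('a \<Rightarrow> real) \<Rightarrow> 'a \<Rightarrow> 'a" where
  "p_flux p u x = (norm (grad u x) powr (p x - 2)) *\<^sub>R grad u x"

text \<open>\<open>\<Delta>\<^bsub>p(x)\<^esub> u \<le> 0\<close> in \<open>S\<close> in the weak sense. For \<open>S\<close> open, \<open>u \<in> C\<^sup>1(S)\<close> and \<open>p > 1\<close> continuous,
  the integrand is continuous with compact support in \<open>S\<close>, so the integral always exists.\<close>

definition p_laplacian_nonpos ::
    "('a::euclidean_space \<Rightarrow> real) \<Rightarrow> 'a set \<Rightarrow> ('a \<Rightarrow> real) \<Rightarrow> bool" where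
  "p_laplacian_nonpos p S u \<longleftrightarrow>
     (\<forall>\<phi>\<in>test_functions S. (\<forall>x. 0 \<le> \<phi> x) \<longrightarrow>
        0 \<le> (LINT x:S|lborel. p_flux p u x \<bullet> grad \<phi> x))"

end

theory Submission
  imports Defs
begin

text \<open>
  The proof is Hopf's. If \<open>u\<close> has zeros in \<open>\<Omega>\<close> without vanishing identically, connectedness gives an
  arbitrarily small ball \<open>B(y, R)\<close> with closure in \<open>\<Omega>\<close>, inside which \<open>u > 0\<close>, and with a zero \<open>x0\<close>
  of \<open>u\<close> on its boundary. As \<open>x0\<close> is a minimum of \<open>u\<close>, the gradient of \<open>u\<close> vanishes there. On the
  other hand \<open>u\<close> lies above a barrier \<open>v\<close> on the annulus \<open>R/2 \<le> |x - y| \<le> R\<close> which is zero at \<open>x0\<close>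
  and has a nonzero derivative in the direction of \<open>y\<close>; this is a contradiction
  (lemma \<open>positive_on_sphere\<close>).

  The barrier is \<open>v(x) = (exp(-\<beta>r) - exp(-\<beta>R)) / \<beta>\<close> with \<open>r = |x - y|\<close>. Since \<open>|\<nabla>v| = exp(-\<beta>r)\<close>,
  its flux is \<open>-H(x) (x - y)\<close> with \<open>H(x) = exp(-\<beta>r(p(x) - 1)) / r\<close>. The derivative of the exponent
  \<open>p\<close> enters multiplied by \<open>log |\<nabla>v| = -\<beta>r\<close>, that is, with a factor of the same order in \<open>\<beta>\<close> as the
  good term; it is absorbed by taking \<open>R\<close> small compared with \<open>(p1 - 1) / L\<close>, and then \<open>\<beta>\<close> is taken
  large, both to make \<open>v\<close> a strict subsolution and to have \<open>v \<le> u\<close> on the inner sphere.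

  As \<open>p\<close> is merely Lipschitz, the flux of \<open>v\<close> need not be differentiable. That \<open>v\<close> is a strict
  subsolution is obtained in the weak form \<open>\<integral> H \<phi> \<le> \<integral> H (x - y) \<bullet> \<nabla>\<phi>\<close> without differentiating \<open>p\<close>:
  the right-hand side is the derivative at \<open>t = 1\<close> of \<open>\<integral> H(x) \<phi>(y + t(x - y)) dx\<close>, and after a change
  of variables this integral is controlled by the decay of \<open>s ^ n * H(y + s(x - y))\<close> in \<open>s = 1/t\<close>,
  where \<open>n\<close> is the dimension (lemmas \<open>dilation_inequality\<close> and \<open>barrier_flux_dilation\<close>).

  The comparison \<open>v \<le> u\<close> (lemma \<open>barrier_comparison\<close>) tests both weak inequalities with the square of
  the positive part of \<open>v - u - \<delta>\<close>. This function is \<open>C\<^sup>1\<close> with compact support in the annulus, and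
  the monotonicity of \<open>a \<mapsto> |a| powr (q - 2) a\<close> makes the two inequalities contradict each other unless
  it is zero. Mollification extends the weak inequality for \<open>u\<close> from smooth to \<open>C\<^sup>1\<close> test functions
  (lemmas \<open>smooth_approximation\<close> and \<open>weak_inequality_C1\<close>).
\<close>

section \<open>Integrals of continuous functions with bounded support\<close>

lemma set_integrable_bounded_support:
  fixes f :: "'a::euclidean_space \<Rightarrow> 'b::euclidean_space"
  assumes "continuous_on UNIV f" and "bounded {x. f x \<noteq> 0}" and "S \<in> sets lborel"
  shows "set_integrable lborel S f"
proof -
  obtain c where c: "{x. f x \<noteq> 0} \<subseteq> cbox (-c) c"
    using bounded_subset_cbox_symmetric[OF assms(2)] by blast
  have "integrable lborel (\<lambda>x. indicator (cbox (-c) c) x *\<^sub>R f x)"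
    by (rule borel_integrable_compact) (use assms(1) continuous_on_subset in auto)
  moreover have "(\<lambda>x. indicator (cbox (-c) c) x *\<^sub>R f x) = f"
    using c by (fastforce simp: indicator_def)
  ultimately have "integrable lborel f" by simp
  then show ?thesis
    unfolding set_integrable_def using assms(3) integrable_mult_indicator by blast
qed

lemma integrable_on_bounded_support:
  fixes f :: "'a::euclidean_space \<Rightarrow> 'b::euclidean_space"
  assumes "continuous_on UNIV f" and "bounded {x. f x \<noteq> 0}"
  shows "f integrable_on UNIV"
  using set_borel_integral_eq_integral(1)[OF set_integrable_bounded_support[OF assms, of UNIV]] by simp

lemma integral_UNIV_eq_cbox:
  fixes f :: "'a::euclidean_space \<Rightarrow> 'b::banach"
  assumes "\<And>x. x \<notin> cbox a b \<Longrightarrow> f x = 0"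
  shows "integral UNIV f = integral (cbox a b) f"
proof -
  have "f = (\<lambda>x. if x \<in> cbox a b then f x else 0)" using assms by auto
  then show ?thesis using integral_restrict_UNIV[of "cbox a b" f] by simp
qed

lemma integral_affinity_UNIV:
  fixes f :: "'a::euclidean_space \<Rightarrow> 'b::euclidean_space"
  assumes "continuous_on UNIV f" and "bounded {x. f x \<noteq> 0}" and "m \<noteq> 0"
  shows "integral UNIV (\<lambda>x. f (m *\<^sub>R x + c)) = (1 / \<bar>m\<bar> ^ DIM('a)) *\<^sub>R integral UNIV f"
proof -
  obtain d where d: "{x. f x \<noteq> 0} \<subseteq> cbox (-d) d"
    using bounded_subset_cbox_symmetric[OF assms(2)] by blast
  have eq: "integral UNIV f = integral (cbox (-d) d) f"
    by (rule integral_UNIV_eq_cbox) (use d in blast)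
  have "f integrable_on cbox (-d) d"
    by (rule integrable_continuous) (use assms(1) continuous_on_subset in auto)
  then have "(f has_integral integral UNIV f) (cbox (-d) d)"
    using eq by (simp add: integrable_integral)
  from has_integral_affinity[OF this assms(3), of c]
  have "((\<lambda>x. f (m *\<^sub>R x + c)) has_integral (1 / \<bar>m\<bar> ^ DIM('a)) *\<^sub>R integral UNIV f) UNIV"
  proof (rule has_integral_on_superset)
    fix x assume x: "x \<notin> (\<lambda>x. (1 / m) *\<^sub>R x + -((1 / m) *\<^sub>R c)) ` cbox (-d) d"
    have "x = (1 / m) *\<^sub>R (m *\<^sub>R x + c) + -((1 / m) *\<^sub>R c)"
      using assms(3) by (simp add: algebra_simps)
    then have "m *\<^sub>R x + c \<notin> cbox (-d) d" using x by blast
    then show "f (m *\<^sub>R x + c) = 0" using d by blast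
  qed auto
  then show ?thesis by (rule integral_unique)
qed

lemma integral_pos_bounded_support:
  fixes f :: "'a::euclidean_space \<Rightarrow> real"
  assumes "continuous_on UNIV f" and "bounded {x. f x \<noteq> 0}"
    and "\<And>x. 0 \<le> f x" and "0 < f z"
  shows "0 < integral UNIV f"
proof -
  obtain d where d: "{x. f x \<noteq> 0} \<subseteq> box (-d) d"
    using bounded_subset_box_symmetric[OF assms(2)] by blast
  then have d': "{x. f x \<noteq> 0} \<subseteq> cbox (-d) d" using box_subset_cbox by blast
  have eq: "integral UNIV f = integral (cbox (-d) d) f"
    by (rule integral_UNIV_eq_cbox) (use d' in blast)
  have z: "z \<in> box (-d) d" using d assms(4) by auto
  have "integral (cbox (-d) d) f \<noteq> 0"
    using integral_cbox_eq_0_iff[of "-d" d f] assms z box_subset_cbox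
    by (metis continuous_on_subset empty_iff less_irrefl subsetD subset_UNIV)
  moreover have "0 \<le> integral UNIV f"
    by (rule integral_nonneg) (use assms integrable_on_bounded_support in auto)
  ultimately show ?thesis using eq by simp
qed

section \<open>Gradients and convolutions\<close>

lemma GDERIV_imp_continuous_on:
  assumes "\<And>x. x \<in> S \<Longrightarrow> GDERIV f x :> D x"
  shows "continuous_on S f"
  using assms unfolding gderiv_def
  by (meson continuous_at_imp_continuous_on has_derivative_continuous)

lemma GDERIV_convolution:
  fixes f g :: "'a::euclidean_space \<Rightarrow> real"
  assumes f: "continuous_on UNIV f" "bounded {x. f x \<noteq> 0}"
    and g: "\<And>x. GDERIV g x :> D x" and D: "continuous_on UNIV D"
  shows "GDERIV (\<lambda>x. integral UNIV (\<lambda>y. f y * g (x - y))) x :>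
    integral UNIV (\<lambda>y. f y *\<^sub>R D (x - y))"
proof -
  obtain c where c: "{x. f x \<noteq> 0} \<subseteq> cbox (-c) c"
    using bounded_subset_cbox_symmetric[OF f(2)] by blast
  have fz: "f y = 0" if "y \<notin> cbox (-c) c" for y using c that by blast
  let ?L = "\<lambda>x y. blinfun_inner_left (f y *\<^sub>R D (x - y))"
  have eq: "integral UNIV (\<lambda>y. f y * g (x - y)) = integral (cbox (-c) c) (\<lambda>y. f y * g (x - y))" for x
    by (rule integral_UNIV_eq_cbox) (simp add: fz)
  have eq2: "integral UNIV (\<lambda>y. f y *\<^sub>R D (x - y)) = integral (cbox (-c) c) (\<lambda>y. f y *\<^sub>R D (x - y))" for x
    by (rule integral_UNIV_eq_cbox) (simp add: fz)
  have contg: "continuous_on UNIV g"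
    using g by (rule GDERIV_imp_continuous_on)
  have cont_comp: "continuous_on S (\<lambda>z. h (k z))" if "continuous_on UNIV h" "continuous_on S k"
    for h :: "'a \<Rightarrow> 'c::topological_space" and S :: "'d::topological_space set" and k
    using continuous_on_compose2[OF that] by auto
  have cD: "continuous_on UNIV (\<lambda>z. f (snd z) *\<^sub>R D (fst z - snd z))"
    by (intro continuous_intros cont_comp[OF f(1)] cont_comp[OF D])
  have iD: "(\<lambda>y. f y *\<^sub>R D (x - y)) integrable_on cbox (-c) c" for x
    by (intro integrable_continuous continuous_intros cont_comp[OF f(1)] cont_comp[OF D])
  have iL: "?L x integrable_on cbox (-c) c" for x
    using integrable_linear[OF iD bounded_linear_blinfun_inner_left] by (simp add: o_def)
  have "((\<lambda>x. integral (cbox (-c) c) (\<lambda>y. f y * g (x - y))) has_derivative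
      blinfun_apply (integral (cbox (-c) c) (?L x))) (at x within UNIV)"
  proof (rule leibniz_rule)
    fix x y :: 'a
    have "((\<lambda>x. g (x - y)) has_derivative (\<lambda>h. h \<bullet> D (x - y))) (at x)"
      by (rule has_derivative_compose[of "\<lambda>x. x - y" "\<lambda>h. h" x UNIV g "\<lambda>h. h \<bullet> D (x - y)"])
        (use g[of "x - y"] in \<open>auto simp: gderiv_def intro!: derivative_eq_intros\<close>)
    then show "((\<lambda>x. f y * g (x - y)) has_derivative blinfun_apply (?L x y)) (at x within UNIV)"
      by (auto intro!: derivative_eq_intros simp: inner_commute)
  next
    fix x show "(\<lambda>y. f y * g (x - y)) integrable_on cbox (-c) c"
      by (intro integrable_continuous continuous_intros cont_comp[OF f(1)] cont_comp[OF contg])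
  next
    show "continuous_on (UNIV \<times> cbox (- c) c) (\<lambda>(x, y). ?L x y)"
      unfolding case_prod_unfold
      by (intro bounded_linear.continuous_on[OF bounded_linear_blinfun_inner_left]
          continuous_on_subset[OF cD]) auto
  qed auto
  moreover have "blinfun_apply (integral (cbox (-c) c) (?L x)) = (\<lambda>h. h \<bullet> integral (cbox (-c) c) (\<lambda>y. f y *\<^sub>R D (x - y)))"
    using integral_linear[OF iD bounded_linear_blinfun_inner_left, of x] by (simp add: o_def fun_eq_iff)
  ultimately show ?thesis
    unfolding gderiv_def eq eq2 by simp
qed

lemma GDERIV_grad:
  assumes "GDERIV f x :> D"
  shows "grad f x = D" "f differentiable (at x)" "partial_deriv f b x = D \<bullet> b"
proof -
  have "(f has_derivative (\<lambda>h. h \<bullet> D)) (at x)" using assms by (simp add: gderiv_def)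
  then have fd: "frechet_derivative f (at x) = (\<lambda>h. h \<bullet> D)" by (metis frechet_derivative_at)
  show "f differentiable (at x)" using assms by (auto simp: gderiv_def differentiable_def)
  show "partial_deriv f b x = D \<bullet> b" by (simp add: partial_deriv_def fd inner_commute)
  show "grad f x = D" 
    by (simp add: grad_def partial_deriv_def fd inner_commute[of _ D] euclidean_representation)
qed

section \<open>Smooth bump functions\<close>

text \<open>The functions \<open>t \<mapsto> exp (-1/t) / t ^ m\<close>, extended by zero to \<open>t \<le> 0\<close>. For \<open>m = 0\<close> this is the
  usual smooth function that vanishes exactly on \<open>t \<le> 0\<close>; the other \<open>m\<close> are there because the
  family is closed under differentiation up to linear combinations.\<close>

definition bump_profile :: "nat \<Rightarrow> real \<Rightarrow> real" where
  "bump_profile m t = (if 0 < t then exp (- 1 / t) / t ^ m else 0)"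

lemma bump_profile_tendsto_0: "((\<lambda>t. exp (- 1 / t) / t ^ m) \<longlongrightarrow> (0::real)) (at_right 0)"
proof -
  have "((\<lambda>t. (inverse t) ^ m / exp (inverse t)) \<longlongrightarrow> (0::real)) (at_right 0)"
    by (rule filterlim_compose[OF tendsto_power_div_exp_0 filterlim_inverse_at_top_right])
  then show ?thesis
    by (simp add: field_simps exp_minus power_inverse)
qed

lemma DERIV_bump_profile:
  "(bump_profile m has_real_derivative bump_profile (m + 2) t - real m * bump_profile (m + 1) t) (at t)"
proof -
  consider "t < 0" | "t = 0" | "0 < t" by linarith
  then show ?thesis
  proof cases
    case 1
    have "((\<lambda>t. 0) has_real_derivative 0) (at t)" by simp
    then have "(bump_profile m has_real_derivative 0) (at t)"
      by (rule has_field_derivative_transform_within_open[of _ _ _ "{..<0}"])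
        (use 1 in \<open>auto simp: bump_profile_def\<close>)
    then show ?thesis using 1 by (simp add: bump_profile_def)
  next
    case 3
    have "((\<lambda>t. exp (- 1 / t) / t ^ m) has_real_derivative
        bump_profile (m + 2) t - real m * bump_profile (m + 1) t) (at t)"
    proof (cases m)
      case 0
      then show ?thesis using 3
        by (auto intro!: derivative_eq_intros simp: bump_profile_def field_simps power2_eq_square)
    next
      case (Suc n)
      have "((\<lambda>t. exp (- 1 / t) / t ^ Suc n) has_real_derivative
         (exp (- 1 / t) * (1 / t\<^sup>2) * t ^ Suc n - exp (- 1 / t) * (real (Suc n) * t ^ n)) / (t ^ Suc n * t ^ Suc n)) (at t)"
        using 3 by (auto intro!: derivative_eq_intros simp: field_simps power2_eq_square simp del: power_Suc)
      moreover have "(exp (- 1 / t) * (1 / t\<^sup>2) * t ^ Suc n - exp (- 1 / t) * (real (Suc n) * t ^ n)) / (t ^ Suc n * t ^ Suc n)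
        = bump_profile (Suc n + 2) t - real (Suc n) * bump_profile (Suc n + 1) t"
        using 3 by (simp add: bump_profile_def field_simps power2_eq_square)
      ultimately show ?thesis by (simp add: Suc)
    qed
    then show ?thesis
      by (rule has_field_derivative_transform_within_open[of _ _ _ "{0<..}"])
        (use 3 in \<open>auto simp: bump_profile_def\<close>)
  next
    case 2
    have "((\<lambda>h. bump_profile m h / h) \<longlongrightarrow> 0) (at 0)"
    proof (rule filterlim_split_at)
      show "((\<lambda>h. bump_profile m h / h) \<longlongrightarrow> 0) (at_left 0)"
        by (rule tendsto_eventually) (auto simp: eventually_at_filter bump_profile_def)
      show "((\<lambda>h. bump_profile m h / h) \<longlongrightarrow> 0) (at_right 0)"
        by (rule Lim_transform_eventually[OF bump_profile_tendsto_0[of "Suc m"]])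
          (auto simp: eventually_at_filter bump_profile_def)
    qed
    then show ?thesis using 2 by (simp add: has_field_derivative_iff bump_profile_def)
  qed
qed

text \<open>An algebra of functions that contains the radial bumps and, together with each member, all its
  directional derivatives. Such closure yields smoothness of every order at once, so no rules for
  higher derivatives of products or compositions are needed.\<close>

inductive bump_algebra :: "('a::euclidean_space \<Rightarrow> real) \<Rightarrow> bool" where
  const: "bump_algebra (\<lambda>x. c)"
| linear: "bump_algebra (\<lambda>x. x \<bullet> b)"
| bump: "bump_algebra (\<lambda>x. bump_profile m (c - x \<bullet> x))"
| add: "bump_algebra f \<Longrightarrow> bump_algebra g \<Longrightarrow> bump_algebra (\<lambda>x. f x + g x)"
| mult: "bump_algebra f \<Longrightarrow> bump_algebra g \<Longrightarrow> bump_algebra (\<lambda>x. f x * g x)"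

lemma bump_algebra_GDERIV:
  assumes "bump_algebra f"
  shows "\<exists>D. (\<forall>x. GDERIV f x :> D x) \<and> (\<forall>b. bump_algebra (\<lambda>x. D x \<bullet> b))"
  using assms
proof induction
  case (const c)
  show ?case
    by (intro exI[of _ "\<lambda>_. 0"]) (auto simp: GDERIV_const intro: bump_algebra.const)
next
  case (linear b)
  show ?case
    by (intro exI[of _ "\<lambda>_. b"])
      (auto simp: gderiv_def intro!: bump_algebra.const bounded_linear_imp_has_derivative
          bounded_linear_inner_left)
next
  case (bump m c)
  let ?k = "\<lambda>x::'a. bump_profile (m + 2) (c - x \<bullet> x) + (- real m) * bump_profile (m + 1) (c - x \<bullet> x)"
  have "GDERIV (\<lambda>x. bump_profile m (c - x \<bullet> x)) x :> (-2 * ?k x) *\<^sub>R x" for x :: 'a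
  proof -
    have "((\<lambda>x. c - x \<bullet> x) has_derivative (\<lambda>h. - 2 * (h \<bullet> x))) (at x)"
      by (auto intro!: derivative_eq_intros simp: inner_commute)
    from has_derivative_compose[OF this DERIV_bump_profile[unfolded has_field_derivative_def]]
    show ?thesis unfolding gderiv_def
      by (rule has_derivative_eq_rhs) (simp add: fun_eq_iff algebra_simps)
  qed
  moreover have "bump_algebra (\<lambda>x. ((-2 * ?k x) *\<^sub>R x) \<bullet> b)" for b
    unfolding inner_scaleR_left
    by (rule bump_algebra.mult bump_algebra.add bump_algebra.linear bump_algebra.bump
        bump_algebra.const)+
  ultimately show ?case by (intro exI[of _ "\<lambda>x. (-2 * ?k x) *\<^sub>R x"]) blast
next
  case (add f g)
  then obtain D E where "\<And>x. GDERIV f x :> D x" "\<And>b. bump_algebra (\<lambda>x. D x \<bullet> b)"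
    "\<And>x. GDERIV g x :> E x" "\<And>b. bump_algebra (\<lambda>x. E x \<bullet> b)" by blast
  then show ?case
    by (intro exI[of _ "\<lambda>x. D x + E x"])
      (auto simp: inner_add_left intro: GDERIV_add bump_algebra.add)
next
  case (mult f g)
  then obtain D E where "\<And>x. GDERIV f x :> D x" "\<And>b. bump_algebra (\<lambda>x. D x \<bullet> b)"
    "\<And>x. GDERIV g x :> E x" "\<And>b. bump_algebra (\<lambda>x. E x \<bullet> b)" by blast
  with mult.hyps show ?case
    by (intro exI[of _ "\<lambda>x. f x *\<^sub>R E x + g x *\<^sub>R D x"])
      (auto simp: inner_add_left intro!: GDERIV_mult bump_algebra.add bump_algebra.mult)
qed

lemma bump_algebra_continuous: "bump_algebra f \<Longrightarrow> continuous_on UNIV f"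
  using bump_algebra_GDERIV GDERIV_imp_continuous_on by blast

lemma bump_algebra_gradient:
  assumes "bump_algebra f"
  obtains D where "\<And>x. GDERIV f x :> D x" "continuous_on UNIV D" "\<And>b. bump_algebra (\<lambda>x. D x \<bullet> b)"
proof -
  obtain D where D: "\<And>x. GDERIV f x :> D x" "\<And>b. bump_algebra (\<lambda>x. D x \<bullet> b)"
    using bump_algebra_GDERIV[OF assms] by blast
  moreover have "continuous_on UNIV D"
    by (subst continuous_on_componentwise) (use D(2) bump_algebra_continuous in blast)
  ultimately show ?thesis using that by blast
qed

text \<open>Each derivative falls on the smooth factor, which stays in \<open>bump_algebra\<close>.\<close>

lemma C_on_convolution:
  fixes f g :: "'a::euclidean_space \<Rightarrow> real"
  assumes f: "continuous_on UNIV f" "bounded {x. f x \<noteq> 0}" and "bump_algebra g"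
  shows "C_on k UNIV (\<lambda>x. integral UNIV (\<lambda>y. f y * g (x - y)))"
  using assms(3)
proof (induction k arbitrary: g)
  case 0
  obtain D where "\<And>x. GDERIV g x :> D x" "continuous_on UNIV D"
    using bump_algebra_gradient[OF 0] by metis
  then show ?case
    using GDERIV_convolution[OF f] by (simp, intro GDERIV_imp_continuous_on) blast
next
  case (Suc k)
  obtain D where D: "\<And>x. GDERIV g x :> D x" "continuous_on UNIV D" "\<And>b. bump_algebra (\<lambda>x. D x \<bullet> b)"
    using bump_algebra_gradient[OF Suc.prems] by metis
  let ?c = "\<lambda>x. integral UNIV (\<lambda>y. f y * g (x - y))"
  have G: "GDERIV ?c x :> integral UNIV (\<lambda>y. f y *\<^sub>R D (x - y))" for x
    by (rule GDERIV_convolution[OF f D(1,2)])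
  have "(\<lambda>y. f y *\<^sub>R D (x - y)) integrable_on UNIV" for x
    by (rule integrable_on_bounded_support)
      (auto intro!: continuous_intros f(1) continuous_on_compose2[OF D(2)] bounded_subset[OF f(2)])
  then have "partial_deriv ?c b x = integral UNIV (\<lambda>y. f y * (D (x - y) \<bullet> b))" for b x
    using GDERIV_grad(3)[OF G] integral_linear[OF _ bounded_linear_inner_left, of "\<lambda>y. f y *\<^sub>R D (x - y)" UNIV b]
    by (simp add: o_def)
  then have "partial_deriv ?c b = (\<lambda>x. integral UNIV (\<lambda>y. f y * (D (x - y) \<bullet> b)))" for b by blast
  with Suc.IH[OF D(3)] GDERIV_grad(2)[OF G] show ?case by simp
qed

section \<open>From smooth to continuously differentiable test functions\<close>

lemma compact_Union_cball:
  fixes K :: "'a::euclidean_space set"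
  assumes "compact K"
  shows "compact (\<Union>x\<in>K. cball x d)"
proof -
  have "(\<Union>x\<in>K. \<Union>y\<in>cball 0 d. {x + y}) = (\<Union>x\<in>K. cball x d)" (is "?L = ?R")
  proof
    show "?L \<subseteq> ?R" by (auto simp: dist_norm)
    show "?R \<subseteq> ?L"
    proof
      fix z assume "z \<in> ?R"
      then obtain x where x: "x \<in> K" "z - x \<in> cball 0 d" by (auto simp: dist_norm norm_minus_commute)
      then have "x + (z - x) \<in> ?L" by blast
      then show "z \<in> ?L" by simp
    qed
  qed
  then show ?thesis using compact_sums'[OF assms compact_cball] by metis
qed

lemma GDERIV_zero_outside:
  fixes \<phi> :: "'a::euclidean_space \<Rightarrow> real"
  assumes "GDERIV \<phi> x :> D" and "closed K" and "\<And>x. x \<notin> K \<Longrightarrow> \<phi> x = 0" and "x \<notin> K"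
  shows "D = 0"
proof -
  have "GDERIV \<phi> x :> 0" unfolding gderiv_def
    by (rule has_derivative_transform_within_open[of "\<lambda>_. 0" _ _ _ "-K"]) (use assms in auto)
  then show ?thesis using assms(1) GDERIV_grad(1) by metis
qed

text \<open>Mollification: a nonnegative \<open>C\<^sup>1\<close> function with compact support is approximated, uniformly with
  its gradient, by nonnegative smooth functions supported near the support of the original one.\<close>

lemma smooth_approximation:
  fixes \<phi> :: "'a::euclidean_space \<Rightarrow> real"
  assumes G: "\<And>x. GDERIV \<phi> x :> G x" and contG: "continuous_on UNIV G"
    and nonneg: "\<And>x. 0 \<le> \<phi> x" and K: "compact K" "\<And>x. x \<notin> K \<Longrightarrow> \<phi> x = 0"
    and "0 < d" "0 < e"
  obtains \<psi> D where "\<And>k. C_on k UNIV \<psi>" "\<And>x. 0 \<le> \<psi> x" "\<And>x. GDERIV \<psi> x :> D x"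
    "continuous_on UNIV D" "\<And>x. norm (D x - G x) \<le> e"
    "\<And>x. \<psi> x \<noteq> 0 \<Longrightarrow> \<exists>y\<in>K. dist y x \<le> d"
proof -
  have cont\<phi>: "continuous_on UNIV \<phi>" using G by (rule GDERIV_imp_continuous_on)
  have bd\<phi>: "bounded {x. \<phi> x \<noteq> 0}"
    by (rule bounded_subset[OF compact_imp_bounded[OF K(1)]]) (use K(2) in blast)
  have Gz: "G x = 0" if "x \<notin> K" for x
    using GDERIV_zero_outside[OF G compact_imp_closed[OF K(1)] K(2) that] .
  have "uniformly_continuous_on UNIV G"
  proof -
    define K' where "K' = (\<Union>x\<in>K. cball x 1)"
    have K'I: "z \<in> K'" if "x \<in> K" "dist z x \<le> 1" for x z
      using that by (auto simp: K'_def dist_commute)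
    have "compact K'" unfolding K'_def using K(1) by (rule compact_Union_cball)
    then have uc: "uniformly_continuous_on K' G"
      using compact_uniformly_continuous contG continuous_on_subset by blast
    show ?thesis unfolding uniformly_continuous_on_def
    proof (intro allI impI)
      fix r :: real assume "0 < r"
      then obtain s where s: "0 < s" "\<And>x y. x \<in> K' \<Longrightarrow> y \<in> K' \<Longrightarrow> dist y x < s \<Longrightarrow> dist (G y) (G x) < r"
        using uc unfolding uniformly_continuous_on_def by metis
      have "dist (G y) (G x) < r" if "dist y x < min s 1" for x y
      proof (cases "x \<in> K \<or> y \<in> K")
        case True
        then have "x \<in> K' \<and> y \<in> K'" using that K'I[of x x] K'I[of x y] K'I[of y y] K'I[of y x]
          by (auto simp: dist_commute)
        then show ?thesis using s that by auto
      next
        case False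
        then show ?thesis using Gz \<open>0 < r\<close> by simp
      qed
      then show "\<exists>d>0. \<forall>x\<in>UNIV. \<forall>x'\<in>UNIV. dist x' x < d \<longrightarrow> dist (G x') (G x) < r"
        using s(1) by (intro exI[of _ "min s 1"]) auto
    qed
  qed
  then obtain s where s: "0 < s" "\<And>x y. dist y x < s \<Longrightarrow> dist (G y) (G x) < e"
    unfolding uniformly_continuous_on_def using \<open>0 < e\<close> by (metis UNIV_I)
  define r where "r = min s d / 2"
  have r: "0 < r" "r < s" "r < d" using s(1) \<open>0 < d\<close> by (auto simp: r_def)
  define \<eta>0 :: "'a \<Rightarrow> real" where "\<eta>0 = (\<lambda>x. bump_profile 0 (r\<^sup>2 - x \<bullet> x))"
  have \<eta>0_nonneg: "0 \<le> \<eta>0 x" for x by (simp add: \<eta>0_def bump_profile_def)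
  have \<eta>0_supp: "norm x < r" if "\<eta>0 x \<noteq> 0" for x
    using that r(1) by (auto simp: \<eta>0_def bump_profile_def dot_square_norm power2_less_imp_less split: if_splits)
  have alg0: "bump_algebra \<eta>0" unfolding \<eta>0_def by (rule bump_algebra.bump)
  have bd0: "bounded {x. \<eta>0 x \<noteq> 0}"
    by (rule boundedI[of _ r]) (use \<eta>0_supp in force)
  define I where "I = integral UNIV \<eta>0"
  have "0 < I" unfolding I_def
    by (rule integral_pos_bounded_support[OF bump_algebra_continuous[OF alg0] bd0 \<eta>0_nonneg, of 0])
      (use r in \<open>simp add: \<eta>0_def bump_profile_def\<close>)
  define \<eta> where "\<eta> = (\<lambda>x. (1 / I) * \<eta>0 x)"
  have alg: "bump_algebra \<eta>" unfolding \<eta>_def using alg0 by (intro bump_algebra.mult bump_algebra.const)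
  have \<eta>_nonneg: "0 \<le> \<eta> x" for x using \<eta>0_nonneg \<open>0 < I\<close> by (simp add: \<eta>_def)
  have \<eta>_supp: "norm x < r" if "\<eta> x \<noteq> 0" for x using that \<eta>0_supp by (auto simp: \<eta>_def)
  have cont\<eta>: "continuous_on UNIV \<eta>" using alg by (rule bump_algebra_continuous)
  have bd: "bounded {x. \<eta> x \<noteq> 0}"
    by (rule boundedI[of _ r]) (use \<eta>_supp in force)
  have int\<eta>: "integral UNIV \<eta> = 1"
    unfolding \<eta>_def using \<open>0 < I\<close> by (simp add: I_def)
  define \<psi> where "\<psi> = (\<lambda>x. integral UNIV (\<lambda>y. \<phi> y * \<eta> (x - y)))"
  define D where "D = (\<lambda>x. integral UNIV (\<lambda>y. \<eta> y *\<^sub>R G (x - y)))"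
  \<comment> \<open>By symmetry of the convolution its derivatives may also fall on \<open>\<phi>\<close>: this identifies the
    gradient of \<open>\<psi>\<close> as the mollification of \<open>G\<close>, which is close to \<open>G\<close>.\<close>
  have \<psi>_eq: "\<psi> = (\<lambda>x. integral UNIV (\<lambda>y. \<eta> y * \<phi> (x - y)))"
  proof
    fix x
    have "integral UNIV (\<lambda>y. \<phi> ((-1) *\<^sub>R y + x) * \<eta> (x - ((-1) *\<^sub>R y + x)))
      = (1 / \<bar>-1\<bar> ^ DIM('a)) *\<^sub>R integral UNIV (\<lambda>y. \<phi> y * \<eta> (x - y))"
      by (rule integral_affinity_UNIV)
        (auto intro!: continuous_intros cont\<phi> continuous_on_compose2[OF cont\<eta>] bounded_subset[OF bd\<phi>])
    then show "\<psi> x = integral UNIV (\<lambda>y. \<eta> y * \<phi> (x - y))"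
      by (simp add: \<psi>_def mult.commute)
  qed
  have smooth: "C_on k UNIV \<psi>" for k
    unfolding \<psi>_def by (rule C_on_convolution[OF cont\<phi> bd\<phi> alg])
  have deriv: "GDERIV \<psi> x :> D x" for x
    unfolding \<psi>_eq D_def by (rule GDERIV_convolution[OF cont\<eta> bd G contG])
  have contD: "continuous_on UNIV D"
  proof (subst continuous_on_componentwise, intro ballI)
    fix b :: 'a assume "b \<in> Basis"
    have "partial_deriv \<psi> b = (\<lambda>x. D x \<bullet> b)" using GDERIV_grad(3)[OF deriv] by blast
    then show "continuous_on UNIV (\<lambda>x. D x \<bullet> b)" using smooth[of "Suc 0"] \<open>b \<in> Basis\<close> by auto
  qed
  have \<psi>_nonneg: "0 \<le> \<psi> x" for x
    unfolding \<psi>_def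
    by (rule integral_nonneg)
      (auto intro!: integrable_on_bounded_support continuous_intros cont\<phi>
        continuous_on_compose2[OF cont\<eta>] bounded_subset[OF bd\<phi>] mult_nonneg_nonneg nonneg \<eta>_nonneg)
  have close: "norm (D x - G x) \<le> e" for x
  proof -
    have i1: "(\<lambda>y. \<eta> y *\<^sub>R G (x - y)) integrable_on UNIV"
      by (auto intro!: integrable_on_bounded_support continuous_intros cont\<eta>
        continuous_on_compose2[OF contG] bounded_subset[OF bd])
    have i2: "\<eta> integrable_on UNIV" using cont\<eta> bd by (rule integrable_on_bounded_support)
    have i3: "(\<lambda>y. \<eta> y *\<^sub>R G x) integrable_on UNIV"
      by (auto intro!: integrable_on_bounded_support continuous_intros cont\<eta> bounded_subset[OF bd])
    have "integral UNIV (\<lambda>y. \<eta> y *\<^sub>R G x) = G x"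
      using integral_linear[OF i2 bounded_linear_scaleR_left[of "G x"]] by (simp add: o_def int\<eta>)
    then have "D x - G x = integral UNIV (\<lambda>y. \<eta> y *\<^sub>R G (x - y) - \<eta> y *\<^sub>R G x)"
      unfolding D_def using integral_diff[OF i1 i3] by simp
    also have "norm \<dots> \<le> integral UNIV (\<lambda>y. \<eta> y * e)"
    proof (rule integral_norm_bound_integral)
      show "(\<lambda>y. \<eta> y * e) integrable_on UNIV" using i2 by (rule integrable_on_mult_left)
      fix y
      show "norm (\<eta> y *\<^sub>R G (x - y) - \<eta> y *\<^sub>R G x) \<le> \<eta> y * e"
      proof (cases "\<eta> y = 0")
        case False
        then have "dist (x - y) x < s" using \<eta>_supp r by (fastforce simp: dist_norm)
        then have "norm (G (x - y) - G x) \<le> e" using s(2) by (metis dist_norm less_imp_le)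
        moreover have "norm (\<eta> y *\<^sub>R G (x - y) - \<eta> y *\<^sub>R G x) = \<eta> y * norm (G (x - y) - G x)"
          using \<eta>_nonneg[of y] by (simp flip: scaleR_diff_right)
        ultimately show ?thesis using \<eta>_nonneg by (simp add: mult_left_mono)
      qed simp
    qed (rule integrable_diff[OF i1 i3])
    also have "\<dots> = e" by (simp add: int\<eta>)
    finally show ?thesis .
  qed
  have supp: "\<exists>y\<in>K. dist y x \<le> d" if "\<psi> x \<noteq> 0" for x
  proof (rule ccontr)
    assume *: "\<not> ?thesis"
    have "\<phi> y * \<eta> (x - y) = 0" for y
    proof (rule ccontr)
      assume "\<phi> y * \<eta> (x - y) \<noteq> 0"
      then have "y \<in> K" "norm (x - y) < r" using K(2) \<eta>_supp by auto
      then show False using * r by (force simp: dist_norm norm_minus_commute)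
    qed
    then have "(\<lambda>y. \<phi> y * \<eta> (x - y)) = (\<lambda>y. 0)" by (rule ext)
    then show False using that by (simp add: \<psi>_def)
  qed
  show ?thesis by (rule that[OF smooth \<psi>_nonneg deriv contD close supp])
qed

lemma continuous_inner_compact_support:
  fixes F G :: "'a::euclidean_space \<Rightarrow> 'a"
  assumes "open S" "continuous_on S F" "continuous_on UNIV G" "compact K" "K \<subseteq> S"
    and z: "\<And>x. x \<notin> K \<Longrightarrow> G x = 0"
  shows "continuous_on UNIV (\<lambda>x. F x \<bullet> G x)" "bounded {x. F x \<bullet> G x \<noteq> 0}"
proof -
  have "continuous_on (S \<union> - K) (\<lambda>x. F x \<bullet> G x)"
  proof (rule continuous_on_open_Un)
    show "continuous_on S (\<lambda>x. F x \<bullet> G x)"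
      using assms by (intro continuous_intros) (auto intro: continuous_on_subset)
    show "continuous_on (- K) (\<lambda>x. F x \<bullet> G x)"
      by (rule continuous_on_eq[of _ "\<lambda>_. 0"]) (auto simp: z)
  qed (use assms compact_imp_closed in auto)
  then show "continuous_on UNIV (\<lambda>x. F x \<bullet> G x)"
    by (rule continuous_on_subset) (use assms in auto)
  show "bounded {x. F x \<bullet> G x \<noteq> 0}"
    by (rule bounded_subset[OF compact_imp_bounded[OF assms(4)]]) (use z in force)
qed

lemma weak_inequality_C1:
  fixes F :: "'a::euclidean_space \<Rightarrow> 'a"
  assumes S: "open S" and F: "continuous_on S F"
    and weak: "\<And>\<psi>. \<psi> \<in> test_functions S \<Longrightarrow> (\<And>x. 0 \<le> \<psi> x) \<Longrightarrow>
      0 \<le> (LINT x:S|lborel. F x \<bullet> grad \<psi> x)"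
    and G: "\<And>x. GDERIV \<phi> x :> G x" and contG: "continuous_on UNIV G"
    and nonneg: "\<And>x. 0 \<le> \<phi> x" and K: "compact K" "K \<subseteq> S" "\<And>x. x \<notin> K \<Longrightarrow> \<phi> x = 0"
  shows "0 \<le> integral UNIV (\<lambda>x. F x \<bullet> G x)"
proof (rule ccontr)
  define I where "I = integral UNIV (\<lambda>x. F x \<bullet> G x)"
  assume "\<not> 0 \<le> integral UNIV (\<lambda>x. F x \<bullet> G x)"
  then have I: "I < 0" by (simp add: I_def)
  obtain d where d: "0 < d" "(\<Union>x\<in>K. cball x d) \<subseteq> S"
    using compact_subset_open_imp_cball_epsilon_subset[OF K(1) S K(2)] by blast
  define K' where "K' = (\<Union>x\<in>K. cball x d)"
  have K': "compact K'" "K' \<subseteq> S" "K \<subseteq> K'"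
    using compact_Union_cball[OF K(1)] d by (auto simp: K'_def)
  have Gz: "G x = 0" if "x \<notin> K'" for x
    by (rule GDERIV_zero_outside[OF G compact_imp_closed[OF K(1)] K(3)]) (use that K'(3) in auto)
  have "compact (F ` K')"
    using compact_continuous_image K'(1) continuous_on_subset[OF F K'(2)] by blast
  then obtain M where M: "0 < M" "\<And>x. x \<in> K' \<Longrightarrow> norm (F x) \<le> M"
    using compact_imp_bounded bounded_pos by (metis imageI)
  obtain c where c: "K' \<subseteq> cbox (-c) c"
    using bounded_subset_cbox_symmetric compact_imp_bounded[OF K'(1)] by blast
  define V where "V = measure lborel (cbox (-c) c)"
  have "0 \<le> V" by (simp add: V_def)
  define e where "e = - I / (M * V + 1)"
  have MV: "0 < M * V + 1" using M(1) \<open>0 \<le> V\<close> by (simp add: add_nonneg_pos)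
  have e: "0 < e" unfolding e_def using I MV by (intro divide_pos_pos) auto
  have "e * (M * V + 1) = - I" using MV by (simp add: e_def)
  then have eI: "M * e * V < - I" using e by (simp add: algebra_simps)
  obtain \<psi> D where \<psi>: "\<And>k. C_on k UNIV \<psi>" "\<And>x. 0 \<le> \<psi> x" "\<And>x. GDERIV \<psi> x :> D x"
    "continuous_on UNIV D" "\<And>x. norm (D x - G x) \<le> e"
    "\<And>x. \<psi> x \<noteq> 0 \<Longrightarrow> \<exists>y\<in>K. dist y x \<le> d"
    using smooth_approximation[OF G contG nonneg K(1,3) d(1) e] by metis
  have supp: "\<psi> x = 0" if "x \<notin> K'" for x
    using \<psi>(6)[of x] that by (auto simp: K'_def)
  have Dz: "D x = 0" if "x \<notin> K'" for x
    by (rule GDERIV_zero_outside[OF \<psi>(3) compact_imp_closed[OF K'(1)] supp that])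
  have cl: "closure {x. \<psi> x \<noteq> 0} \<subseteq> K'"
    by (rule closure_minimal) (use supp compact_imp_closed[OF K'(1)] in auto)
  then have "compact (closure {x. \<psi> x \<noteq> 0})"
    using compact_Int_closed[OF K'(1) closed_closure] by (metis inf.absorb2)
  then have "\<psi> \<in> test_functions S"
    using \<psi>(1) cl K'(2) by (auto simp: test_functions_def)
  then have "0 \<le> (LINT x:S|lborel. F x \<bullet> grad \<psi> x)"
    using weak \<psi>(2) by blast
  also have "\<dots> = (LINT x:S|lborel. F x \<bullet> D x)"
    by (simp add: GDERIV_grad(1)[OF \<psi>(3)])
  also have "\<dots> = integral S (\<lambda>x. F x \<bullet> D x)"
    by (intro set_borel_integral_eq_integral(2) set_integrable_bounded_support
        continuous_inner_compact_support[OF S F \<psi>(4) K'(1,2) Dz]) (use S in auto)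
  also have "\<dots> = integral UNIV (\<lambda>x. if x \<in> S then F x \<bullet> D x else 0)"
    by (simp add: integral_restrict_UNIV)
  also have "(\<lambda>x. if x \<in> S then F x \<bullet> D x else 0) = (\<lambda>x. F x \<bullet> D x)"
    using Dz K'(2) by (fastforce simp: fun_eq_iff)
  finally have 0: "0 \<le> integral UNIV (\<lambda>x. F x \<bullet> D x)" .
  have iD: "(\<lambda>x. F x \<bullet> D x) integrable_on UNIV"
    by (intro integrable_on_bounded_support
        continuous_inner_compact_support[OF S F \<psi>(4) K'(1,2) Dz])
  have iG: "(\<lambda>x. F x \<bullet> G x) integrable_on UNIV"
    by (intro integrable_on_bounded_support
        continuous_inner_compact_support[OF S F contG K'(1,2) Gz])
  have "integral UNIV (\<lambda>x. F x \<bullet> D x) - I = integral UNIV (\<lambda>x. F x \<bullet> D x - F x \<bullet> G x)"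
    unfolding I_def using integral_diff[OF iD iG] by simp
  also have "\<dots> = integral (cbox (-c) c) (\<lambda>x. F x \<bullet> D x - F x \<bullet> G x)"
  proof (rule integral_UNIV_eq_cbox)
    fix x assume "x \<notin> cbox (-c) c"
    then have "x \<notin> K'" using c by blast
    then show "F x \<bullet> D x - F x \<bullet> G x = 0" by (simp add: Dz Gz)
  qed
  also have "\<dots> \<le> M * e * measure lborel (cbox (-c) c)"
  proof -
    have "norm (integral (cbox (-c) c) (\<lambda>x. F x \<bullet> D x - F x \<bullet> G x)) \<le> M * e * measure lborel (cbox (-c) c)"
    proof (rule integrable_bound)
      show "0 \<le> M * e" using M(1) e by simp
      show "(\<lambda>x. F x \<bullet> D x - F x \<bullet> G x) integrable_on cbox (- c) c"
        by (rule integrable_on_subcbox[OF integrable_diff[OF iD iG]]) simp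
      fix x
      show "norm (F x \<bullet> D x - F x \<bullet> G x) \<le> M * e"
      proof (cases "x \<in> K'")
        case True
        have "norm (F x \<bullet> (D x - G x)) \<le> norm (F x) * norm (D x - G x)"
          unfolding real_norm_def by (rule Cauchy_Schwarz_ineq2)
        also have "\<dots> \<le> M * e"
          by (rule mult_mono) (use M True \<psi>(5) in auto)
        finally show ?thesis by (simp add: inner_diff_right)
      next
        case False
        then show ?thesis using Dz Gz M(1) e by simp
      qed
    qed
    then show ?thesis by simp
  qed
  finally show False using eI 0 I unfolding V_def by linarith
qed

section \<open>Radial fields that decay under dilations\<close>

text \<open>A weak form of \<open>div (H(x) (x - y)) \<le> -H\<close> for a continuous \<open>H\<close>: for differentiable \<open>H\<close>, the
  derivative at \<open>s = 1\<close> of the hypothesis on dilations says exactly this. No derivative of \<open>H\<close>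
  is used; the dilations are moved to the test function by a change of variables instead.\<close>

lemma dilation_inequality:
  fixes H \<phi> :: "'a::euclidean_space \<Rightarrow> real"
  assumes H: "continuous_on UNIV H"
    and G: "\<And>x. GDERIV \<phi> x :> G x" and contG: "continuous_on UNIV G"
    and nonneg: "\<And>x. 0 \<le> \<phi> x"
    and K: "compact K" "K \<subseteq> A" "\<And>x. x \<notin> K \<Longrightarrow> \<phi> x = 0" and A: "open A"
    and decr: "\<And>x s. x \<in> A \<Longrightarrow> 1 \<le> s \<Longrightarrow> y + s *\<^sub>R (x - y) \<in> A \<Longrightarrow>
      s ^ DIM('a) * H (y + s *\<^sub>R (x - y)) \<le> exp (- (s - 1)) * H x"
  shows "integral UNIV (\<lambda>x. H x * \<phi> x) \<le> integral UNIV (\<lambda>x. H x * (G x \<bullet> (x - y)))"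
proof -
  define J where "J = integral UNIV (\<lambda>x. H x * \<phi> x)"
  define g where "g = (\<lambda>t. integral UNIV (\<lambda>x. H x * \<phi> (y + t *\<^sub>R (x - y))))"
  have cont\<phi>: "continuous_on UNIV \<phi>" using G by (rule GDERIV_imp_continuous_on)
  have cont_comp: "continuous_on S (\<lambda>z. h (k z))" if "continuous_on UNIV h" "continuous_on S k"
    for h :: "'a \<Rightarrow> 'c::topological_space" and S :: "'d::topological_space set" and k
    using continuous_on_compose2[OF that] by auto
  have bd\<phi>: "bounded {x. \<phi> x \<noteq> 0}"
    by (rule bounded_subset[OF compact_imp_bounded[OF K(1)]]) (use K(3) in blast)
  obtain \<rho> where \<rho>: "0 < \<rho>" "K \<subseteq> cball y \<rho>"
    using bounded_subset_ballD[OF compact_imp_bounded[OF K(1)]] ball_subset_cball by (metis subset_trans)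
  obtain d where d: "0 < d" "(\<Union>x\<in>K. cball x d) \<subseteq> A"
    using compact_subset_open_imp_cball_epsilon_subset[OF K(1) A K(2)] by blast
  obtain c where c: "cball y (2 * \<rho>) \<subseteq> cbox (-c) c"
    using bounded_subset_cbox_symmetric[OF bounded_cball] by blast
  have far: "y + t *\<^sub>R (x - y) \<notin> K" if "t \<in> {1/2..1}" "x \<notin> cbox (-c) c" for t x
  proof
    assume "y + t *\<^sub>R (x - y) \<in> K"
    then have "norm (t *\<^sub>R (x - y)) \<le> \<rho>" using \<rho>(2) by (force simp: dist_norm)
    then have 1: "t * norm (x - y) \<le> \<rho>" using that(1) by simp
    have "1/2 * norm (x - y) \<le> t * norm (x - y)" using that(1) by (intro mult_right_mono) auto
    then have "norm (x - y) \<le> 2 * \<rho>" using 1 by linarith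
    then have "x \<in> cball y (2 * \<rho>)" by (simp add: dist_norm norm_minus_commute)
    then show False using c that(2) by blast
  qed
  have Gz: "G x = 0" if "x \<notin> K" for x
    by (rule GDERIV_zero_outside[OF G compact_imp_closed[OF K(1)] K(3) that])
  have "((\<lambda>t. integral (cbox (-c) c) (\<lambda>x. H x * \<phi> (y + t *\<^sub>R (x - y)))) has_field_derivative
      integral (cbox (-c) c) (\<lambda>x. H x * (G (y + 1 *\<^sub>R (x - y)) \<bullet> (x - y)))) (at 1 within {1/2..1})"
  proof (rule leibniz_rule_field_derivative)
    fix t :: real and x
    have "((\<lambda>t. y + t *\<^sub>R (x - y)) has_derivative (\<lambda>h. h *\<^sub>R (x - y))) (at t within {1/2..1})"
      by (auto intro!: derivative_eq_intros)
    from has_derivative_compose[OF this G[unfolded gderiv_def]]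
    have "((\<lambda>t. \<phi> (y + t *\<^sub>R (x - y))) has_field_derivative (G (y + t *\<^sub>R (x - y)) \<bullet> (x - y)))
        (at t within {1/2..1})"
      unfolding has_field_derivative_def
      by (rule has_derivative_eq_rhs) (simp add: fun_eq_iff inner_commute)
    then show "((\<lambda>t. H x * \<phi> (y + t *\<^sub>R (x - y))) has_field_derivative
        H x * (G (y + t *\<^sub>R (x - y)) \<bullet> (x - y))) (at t within {1/2..1})"
      by (rule DERIV_cmult)
  next
    fix t :: real
    show "(\<lambda>x. H x * \<phi> (y + t *\<^sub>R (x - y))) integrable_on cbox (-c) c"
      by (intro integrable_continuous continuous_intros cont_comp[OF H] cont_comp[OF cont\<phi>])
  next
    show "continuous_on ({1/2..1} \<times> cbox (-c) c)
        (\<lambda>(t, x). H x * (G (y + t *\<^sub>R (x - y)) \<bullet> (x - y)))"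
      unfolding case_prod_unfold
      by (intro continuous_intros cont_comp[OF H] cont_comp[OF contG])
  qed auto
  moreover have "integral (cbox (-c) c) (\<lambda>x. H x * (G (y + 1 *\<^sub>R (x - y)) \<bullet> (x - y)))
      = integral UNIV (\<lambda>x. H x * (G x \<bullet> (x - y)))" (is "_ = ?D")
    using far[of 1] Gz by (subst integral_UNIV_eq_cbox[of "-c" c]) auto
  ultimately have "((\<lambda>t. integral (cbox (-c) c) (\<lambda>x. H x * \<phi> (y + t *\<^sub>R (x - y))))
      has_field_derivative ?D) (at 1 within {1/2..1})" by simp
  then have der: "(g has_field_derivative ?D) (at 1 within {1/2..1})"
  proof (rule has_field_derivative_transform_within[of _ _ _ _ 1])
    fix t :: real assume "t \<in> {1/2..1}"
    then show "integral (cbox (-c) c) (\<lambda>x. H x * \<phi> (y + t *\<^sub>R (x - y))) = g t"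
      unfolding g_def by (intro integral_UNIV_eq_cbox[symmetric]) (use far K(3) in auto)
  qed auto
  \<comment> \<open>Substitution of \<open>y + (z - y) / t\<close> for \<open>x\<close>. The last condition on \<open>t\<close> keeps the dilated
    support of \<open>\<phi>\<close> inside \<open>A\<close>.\<close>
  have bound: "g t \<le> exp (1 - 1 / t) * J" if t: "0 < t" "t \<le> 1" "(1 / t - 1) * \<rho> \<le> d" for t
  proof -
    define s where "s = 1 / t"
    have s: "1 \<le> s" "s * t = 1" using t by (auto simp: s_def)
    let ?f = "\<lambda>z. H (y + s *\<^sub>R (z - y)) * \<phi> z"
    have cf: "continuous_on UNIV ?f" by (intro continuous_intros cont_comp[OF H] cont_comp[OF cont\<phi>])
    have bf: "bounded {z. ?f z \<noteq> 0}" by (rule bounded_subset[OF bd\<phi>]) auto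
    have bJ: "bounded {z. H z * \<phi> z \<noteq> 0}" by (rule bounded_subset[OF bd\<phi>]) auto
    have "?f (t *\<^sub>R x + (y - t *\<^sub>R y)) = H x * \<phi> (y + t *\<^sub>R (x - y))" for x
    proof -
      have "t *\<^sub>R x + (y - t *\<^sub>R y) = y + t *\<^sub>R (x - y)" by (simp add: algebra_simps)
      moreover have "y + s *\<^sub>R (y + t *\<^sub>R (x - y) - y) = x" using s(2) by simp
      ultimately show ?thesis by (simp only:)
    qed
    then have "g t = (1 / \<bar>t\<bar> ^ DIM('a)) *\<^sub>R integral UNIV ?f"
      unfolding g_def using integral_affinity_UNIV[OF cf bf, of t "y - t *\<^sub>R y"] t(1) by simp
    also have "\<dots> = integral UNIV (\<lambda>z. s ^ DIM('a) * ?f z)"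
      using t(1) by (simp add: s_def power_one_over)
    also have "\<dots> \<le> integral UNIV (\<lambda>z. exp (- (s - 1)) * (H z * \<phi> z))"
    proof (rule integral_le)
      show "(\<lambda>z. s ^ DIM('a) * ?f z) integrable_on UNIV"
        using integrable_on_bounded_support[OF cf bf] by (rule integrable_on_mult_right)
      show "(\<lambda>z. exp (- (s - 1)) * (H z * \<phi> z)) integrable_on UNIV"
        by (intro integrable_on_mult_right integrable_on_bounded_support[OF _ bJ]
            continuous_intros H cont\<phi>)
      fix z :: 'a
      show "s ^ DIM('a) * ?f z \<le> exp (- (s - 1)) * (H z * \<phi> z)"
      proof (cases "z \<in> K")
        case True
        have "dist z (y + s *\<^sub>R (z - y)) = (s - 1) * norm (z - y)"
        proof -
          have "z - (y + s *\<^sub>R (z - y)) = (1 - s) *\<^sub>R (z - y)" by (simp add: algebra_simps)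
          then show ?thesis using s(1) by (simp add: dist_norm)
        qed
        also have "\<dots> \<le> (s - 1) * \<rho>"
          using True \<rho>(2) s(1) by (intro mult_left_mono) (auto simp: dist_norm norm_minus_commute)
        also have "\<dots> \<le> d" using t(3) by (simp add: s_def)
        finally have "y + s *\<^sub>R (z - y) \<in> cball z d" by (simp only: mem_cball)
        then have "y + s *\<^sub>R (z - y) \<in> A" using d(2) True by blast
        then have "s ^ DIM('a) * H (y + s *\<^sub>R (z - y)) \<le> exp (- (s - 1)) * H z"
          using decr s(1) True K(2) by blast
        from mult_right_mono[OF this nonneg[of z]] show ?thesis by (simp add: mult_ac)
      qed (simp add: K(3))
    qed
    also have "\<dots> = exp (1 - 1 / t) * J" by (simp add: J_def s_def)
    finally show ?thesis .
  qed
  \<comment> \<open>\<open>k \<le> 0\<close> to the left of \<open>1\<close> and \<open>k 1 = 0\<close>, so the left derivative of \<open>k\<close> at \<open>1\<close> is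
    nonnegative.\<close>
  define k where "k = (\<lambda>t. g t - exp (1 - 1 / t) * J)"
  have "((\<lambda>t. exp (1 - 1 / t) * J) has_field_derivative J) (at 1 within {1/2..1})"
    by (auto intro!: derivative_eq_intros)
  from DERIV_diff[OF der this] have "(k has_real_derivative ?D - J) (at 1 within {1/2..1})"
    by (simp add: k_def)
  moreover have k1: "k 1 = 0" by (simp add: k_def g_def J_def)
  ultimately have "\<not> ?D - J < 0"
  proof (intro notI)
    assume "(k has_real_derivative ?D - J) (at 1 within {1/2..1})" "?D - J < 0"
    from has_real_derivative_neg_dec_left[OF this] obtain d' where
      d': "0 < d'" "\<And>h. 0 < h \<Longrightarrow> 1 - h \<in> {1/2..1} \<Longrightarrow> h < d' \<Longrightarrow> k 1 < k (1 - h)" by blast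
    define h where "h = min (d' / 2) (min (1/2) (d / (2 * \<rho>)))"
    have h: "0 < h" "h \<le> 1/2" "h < d'" "h \<le> d / (2 * \<rho>)"
      using d'(1) d(1) \<rho>(1) by (auto simp: h_def)
    have "1 / (1 - h) - 1 \<le> 2 * h"
    proof -
      have "1 / (1 - h) - 1 = h / (1 - h)" using h by (simp add: field_simps)
      also have "\<dots> \<le> h / (1/2)" using h by (intro divide_left_mono) auto
      finally show ?thesis by simp
    qed
    then have "(1 / (1 - h) - 1) * \<rho> \<le> 2 * h * \<rho>" using \<rho>(1) by (intro mult_right_mono) auto
    also have "\<dots> \<le> d" using h(4) \<rho>(1) by (simp add: field_simps)
    finally have "k (1 - h) \<le> 0" using bound[of "1 - h"] h by (simp add: k_def)
    moreover have "k 1 < k (1 - h)" using d'(2) h by auto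
    ultimately show False using k1 by simp
  qed
  then show ?thesis by (simp add: J_def)
qed

section \<open>The flux of a continuously differentiable function\<close>

lemma C1_gradient:
  fixes u :: "'a::euclidean_space \<Rightarrow> real"
  assumes "C_on 1 S u"
  shows "\<And>x. x \<in> S \<Longrightarrow> GDERIV u x :> grad u x" and "continuous_on S (grad u)"
proof -
  have u: "\<And>x. x \<in> S \<Longrightarrow> u differentiable (at x)" "\<And>b. b \<in> Basis \<Longrightarrow> continuous_on S (partial_deriv u b)"
    using assms by auto
  show "GDERIV u x :> grad u x" if "x \<in> S" for x
  proof -
    let ?f = "frechet_derivative u (at x)"
    have d: "(u has_derivative ?f) (at x)" using u(1)[OF that] by (simp add: frechet_derivative_works)
    then have lin: "linear ?f" by (rule has_derivative_linear)
    have "?f h = h \<bullet> grad u x" for h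
    proof -
      have "?f h = ?f (\<Sum>b\<in>Basis. (h \<bullet> b) *\<^sub>R b)" by (simp add: euclidean_representation)
      also have "\<dots> = (\<Sum>b\<in>Basis. (h \<bullet> b) * ?f b)"
        using lin by (simp add: linear_sum linear_cmul)
      also have "\<dots> = h \<bullet> grad u x"
        by (simp add: grad_def partial_deriv_def inner_sum_right mult.commute)
      finally show ?thesis .
    qed
    then have "?f = (\<lambda>h. h \<bullet> grad u x)" by blast
    then show ?thesis using d by (simp add: gderiv_def)
  qed
  have "continuous_on S (\<lambda>x. \<Sum>b\<in>Basis. partial_deriv u b x *\<^sub>R b)"
    by (intro continuous_intros u(2))
  then show "continuous_on S (grad u)" by (simp add: grad_def[abs_def])
qed

text \<open>For \<open>r = 0\<close> both sides are zero, as \<open>0 powr a = 0\<close> for every \<open>a\<close>.\<close>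

lemma powr_times_self:
  fixes r :: real assumes "0 \<le> r" shows "r powr (q - 2) * r = r powr (q - 1)"
proof (cases "r = 0")
  case False
  then have "r powr (q - 2) * r powr 1 = r powr (q - 1)"
    by (simp only: powr_add[symmetric]) simp
  then show ?thesis using assms False by simp
qed simp

lemma flux_monotone:
  fixes a b :: "'a::real_inner"
  assumes "1 < q"
  shows "0 \<le> (norm a powr (q - 2) *\<^sub>R a - norm b powr (q - 2) *\<^sub>R b) \<bullet> (a - b)"
proof -
  define A B s t where "A = norm a" and "B = norm b" and "s = A powr (q - 2)" and "t = B powr (q - 2)"
  have AB: "0 \<le> A" "0 \<le> B" "0 \<le> s" "0 \<le> t" by (auto simp: A_def B_def s_def t_def)
  have sA: "s * A = A powr (q - 1)" "t * B = B powr (q - 1)"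
    using powr_times_self AB by (auto simp: s_def t_def)
  have "0 \<le> (A powr (q - 1) - B powr (q - 1)) * (A - B)"
  proof (cases "A \<le> B")
    case True
    then have "A powr (q - 1) \<le> B powr (q - 1)" using AB assms by (intro powr_mono2) auto
    then show ?thesis using True by (intro mult_nonpos_nonpos) auto
  next
    case False
    then have "B powr (q - 1) \<le> A powr (q - 1)" using AB assms by (intro powr_mono2) auto
    then show ?thesis using False by (intro mult_nonneg_nonneg) auto
  qed
  also have "\<dots> = s * A * A + t * B * B - (s + t) * (A * B)"
    unfolding sA[symmetric] by (simp add: algebra_simps)
  also have "\<dots> \<le> s * A * A + t * B * B - (s + t) * (a \<bullet> b)"
  proof -
    have "a \<bullet> b \<le> A * B" unfolding A_def B_def by (rule norm_cauchy_schwarz)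
    then have "(s + t) * (a \<bullet> b) \<le> (s + t) * (A * B)" using AB by (intro mult_left_mono) auto
    then show ?thesis by simp
  qed
  also have "\<dots> = (s *\<^sub>R a - t *\<^sub>R b) \<bullet> (a - b)"
    by (simp add: A_def B_def inner_diff_left inner_diff_right inner_commute algebra_simps
        dot_square_norm power2_eq_square)
  finally show ?thesis by (simp add: A_def B_def s_def t_def)
qed

lemma continuous_on_flux:
  fixes g :: "'a::euclidean_space \<Rightarrow> 'a"
  assumes g: "continuous_on S g" and p: "continuous_on S p" "\<And>x. x \<in> S \<Longrightarrow> 1 < p x"
  shows "continuous_on S (\<lambda>x. norm (g x) powr (p x - 2) *\<^sub>R g x)"
  unfolding continuous_on_def
proof
  fix x assume x: "x \<in> S"
  have gl: "(g \<longlongrightarrow> g x) (at x within S)" and pl: "(p \<longlongrightarrow> p x) (at x within S)"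
    using g p(1) x by (auto simp: continuous_on_def)
  show "((\<lambda>x. norm (g x) powr (p x - 2) *\<^sub>R g x) \<longlongrightarrow> norm (g x) powr (p x - 2) *\<^sub>R g x) (at x within S)"
  proof (cases "g x = 0")
    case False
    then show ?thesis by (intro tendsto_intros gl pl) auto
  next
    case True
    have "((\<lambda>x. norm (g x) powr (p x - 1)) \<longlongrightarrow> norm (g x) powr (p x - 1)) (at x within S)"
      using p(2)[OF x] by (intro tendsto_powr' tendsto_intros gl pl) auto
    then have "((\<lambda>x. norm (norm (g x) powr (p x - 2) *\<^sub>R g x)) \<longlongrightarrow> 0) (at x within S)"
      using True by (simp add: powr_times_self)
    then show ?thesis using True tendsto_norm_zero_cancel by fastforce
  qed
qed

section \<open>The barrier and the comparison principle\<close>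

lemma DERIV_positive_part_square:
  "((\<lambda>t::real. (max 0 t)\<^sup>2) has_real_derivative 2 * max 0 t) (at t)"
proof -
  consider "t < 0" | "t = 0" | "0 < t" by linarith
  then show ?thesis
  proof cases
    case 1
    have "((\<lambda>t. 0) has_real_derivative 2 * max 0 t) (at t)" using 1 by simp
    then show ?thesis
      by (rule has_field_derivative_transform_within_open[of _ _ _ "{..<0}"]) (use 1 in auto)
  next
    case 3
    have "((\<lambda>t. t\<^sup>2) has_real_derivative 2 * max 0 t) (at t)"
      using 3 by (auto intro!: derivative_eq_intros)
    then show ?thesis
      by (rule has_field_derivative_transform_within_open[of _ _ _ "{0<..}"]) (use 3 in auto)
  next
    case 2
    have "((\<lambda>h::real. (max 0 h)\<^sup>2 / h) \<longlongrightarrow> 0) (at 0)"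
    proof (rule Lim_null_comparison)
      show "\<forall>\<^sub>F h in at 0. norm ((max 0 h)\<^sup>2 / h) \<le> \<bar>h\<bar>"
        by (rule always_eventually) (auto simp: max_def power2_eq_square)
      show "((\<lambda>h::real. \<bar>h\<bar>) \<longlongrightarrow> 0) (at 0)"
        by (intro tendsto_rabs_zero tendsto_ident_at)
    qed
    then show ?thesis using 2 by (simp add: has_field_derivative_iff)
  qed
qed

text \<open>A radially decreasing function about \<open>y\<close> that vanishes on the sphere of radius \<open>R\<close>. It is
  normalised so that the norm of its gradient is \<open>exp (- \<beta> r)\<close> with no prefactor: then powers of
  that norm have the exact logarithm \<open>- \<beta> r (q - 1)\<close>.\<close>

definition barrier :: "'a::euclidean_space \<Rightarrow> real \<Rightarrow> real \<Rightarrow> 'a \<Rightarrow> real" where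
  "barrier y R \<beta> x = (exp (- (\<beta> * norm (x - y))) - exp (- (\<beta> * R))) / \<beta>"

lemma GDERIV_barrier:
  assumes "x \<noteq> y" "\<beta> \<noteq> 0"
  shows "GDERIV (barrier y R \<beta>) x :> - ((exp (- (\<beta> * norm (x - y))) / norm (x - y)) *\<^sub>R (x - y))"
proof -
  have "((\<lambda>x. norm (x - y)) has_derivative (\<lambda>h. h \<bullet> sgn (x - y))) (at x)"
    by (rule has_derivative_compose[of "\<lambda>x. x - y" "\<lambda>h. h" x UNIV norm "\<lambda>h. h \<bullet> sgn (x - y)"])
      (use has_derivative_norm[of "x - y"] assms(1) in \<open>auto intro!: derivative_eq_intros\<close>)
  moreover have "((\<lambda>r. (exp (- (\<beta> * r)) - exp (- (\<beta> * R))) / \<beta>) has_derivative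
      (*) (- exp (- (\<beta> * norm (x - y))))) (at (norm (x - y)))"
    unfolding has_field_derivative_def[symmetric]
    using assms(2) by (auto intro!: derivative_eq_intros simp: field_simps)
  ultimately have "(barrier y R \<beta> has_derivative
      (\<lambda>h. - exp (- (\<beta> * norm (x - y))) * (h \<bullet> sgn (x - y)))) (at x)"
    unfolding barrier_def[abs_def] by (rule has_derivative_compose)
  then show ?thesis unfolding gderiv_def
    by (rule has_derivative_eq_rhs) (simp add: fun_eq_iff sgn_div_norm divide_inverse)
qed

lemma barrier_flux:
  fixes x y :: "'a::real_normed_vector" and \<beta> :: real
  assumes "x \<noteq> y"
  defines "D \<equiv> - ((exp (- (\<beta> * norm (x - y))) / norm (x - y)) *\<^sub>R (x - y))"
  shows "norm D powr (q - 2) *\<^sub>R D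
    = - ((exp (- (\<beta> * norm (x - y) * (q - 1))) / norm (x - y)) *\<^sub>R (x - y))"
proof -
  let ?r = "norm (x - y)"
  have "norm D = exp (- (\<beta> * ?r))" using assms(1) by (simp add: D_def)
  then have "norm D powr (q - 2) * exp (- (\<beta> * ?r)) = exp (- (\<beta> * ?r)) powr (q - 1)"
    by (simp add: powr_times_self)
  also have "\<dots> = exp (- (\<beta> * ?r * (q - 1)))" by (simp add: powr_def algebra_simps)
  finally show ?thesis by (simp add: D_def)
qed

text \<open>The hypothesis of \<open>dilation_inequality\<close> for the flux of the barrier. On the exponential scale,
  dilating by \<open>s\<close> gains \<open>\<beta> r (s - 1) (p1 - 1)\<close> and loses at most \<open>\<beta> r (s - 1) L R\<close> through the
  variation of \<open>p\<close>. The smallness of \<open>R\<close> leaves half of the gain, and the lower bound on \<open>\<beta>\<close> lets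
  this half outweigh the factor \<open>s ^ n\<close> and \<open>exp (s - 1)\<close>.\<close>

lemma barrier_flux_dilation:
  fixes x y :: "'a::euclidean_space"
  assumes R: "0 < R" and p1: "1 < p1" and lip: "L-lipschitz_on S p"
    and pS: "\<And>x. x \<in> S \<Longrightarrow> p1 \<le> p x"
    and LR: "L * R \<le> (p1 - 1) / 2" and \<beta>: "4 * (real DIM('a) + 1) \<le> \<beta> * R * (p1 - 1)"
    and s: "1 \<le> s" and x: "x \<in> S" and z: "y + s *\<^sub>R (x - y) \<in> S"
    and r: "R / 2 \<le> norm (x - y)" "norm (x - y) \<le> R"
  defines "H \<equiv> \<lambda>x. exp (- (\<beta> * norm (x - y) * (p x - 1))) / norm (x - y)"
  shows "s ^ DIM('a) * H (y + s *\<^sub>R (x - y)) \<le> exp (- (s - 1)) * H x"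
proof -
  define n where "n = DIM('a)"
  define r z where "r = norm (x - y)" and "z = y + s *\<^sub>R (x - y)"
  have r0: "0 < r" "R / 2 \<le> r" "r \<le> R" using R r by (auto simp: r_def)
  have nz: "norm (z - y) = s * r" using s by (simp add: z_def r_def)
  have L0: "0 \<le> L" using lip by (simp add: lipschitz_on_def)
  have \<beta>0: "0 < \<beta>"
  proof -
    have "0 < 4 * (real DIM('a) + 1)" by simp
    also have "\<dots> \<le> \<beta> * (R * (p1 - 1))" using \<beta> by (simp add: mult.assoc)
    finally show ?thesis by (rule zero_less_mult_pos2) (use R p1 in simp)
  qed
  have "(s - 1) * (p1 - 1) / 2 \<le> s * (p z - 1) - (p x - 1)"
  proof -
    have "dist x z = (s - 1) * r"
    proof -
      have "x - z = (1 - s) *\<^sub>R (x - y)" by (simp add: z_def algebra_simps)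
      then show ?thesis using s by (simp add: dist_norm r_def)
    qed
    then have "\<bar>p x - p z\<bar> \<le> L * ((s - 1) * r)"
      using lipschitz_onD[OF lip x z] by (simp add: z_def dist_real_def)
    also have "\<dots> = (s - 1) * (L * r)" by simp
    also have "\<dots> \<le> (s - 1) * ((p1 - 1) / 2)"
    proof -
      have "L * r \<le> L * R" using L0 r0 by (intro mult_left_mono) auto
      then show ?thesis using LR s by (intro mult_left_mono) auto
    qed
    finally have "\<bar>p x - p z\<bar> \<le> (s - 1) * (p1 - 1) / 2" by simp
    then have 1: "p x - p z \<le> (s - 1) * (p1 - 1) / 2" by (rule order_trans[OF abs_ge_self])
    have "(s - 1) * (p1 - 1) \<le> (s - 1) * (p z - 1)"
      using s pS[OF z] by (intro mult_left_mono) (auto simp: z_def)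
    moreover have "s * (p z - 1) - (p x - 1) = (s - 1) * (p z - 1) + (p z - p x)"
      by (simp add: algebra_simps)
    ultimately show ?thesis using 1 by linarith
  qed
  then have "\<beta> * r * ((s - 1) * (p1 - 1) / 2) \<le> \<beta> * r * (s * (p z - 1) - (p x - 1))"
    using \<beta>0 r0 by (intro mult_left_mono) auto
  moreover have "(s - 1) * (real n + 1) \<le> \<beta> * r * ((s - 1) * (p1 - 1) / 2)"
  proof -
    have "\<beta> * (R / 2) * (p1 - 1) \<le> \<beta> * r * (p1 - 1)"
      using \<beta>0 r0 p1 by (intro mult_right_mono mult_left_mono) auto
    then have "real n + 1 \<le> \<beta> * r * (p1 - 1) / 2" using \<beta> by (simp add: n_def)
    then have "(s - 1) * (real n + 1) \<le> (s - 1) * (\<beta> * r * (p1 - 1) / 2)"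
      using s by (intro mult_left_mono) auto
    then show ?thesis by (simp add: mult_ac)
  qed
  ultimately have "(s - 1) * (real n + 1) \<le> \<beta> * r * (s * (p z - 1) - (p x - 1))"
    by linarith
  then have expo: "real n * (s - 1) - \<beta> * (s * r) * (p z - 1) \<le> - (s - 1) - \<beta> * r * (p x - 1)"
    by (simp add: algebra_simps)
  have "s ^ n \<le> exp (s - 1) ^ n"
    using s exp_ge_add_one_self[of "s - 1"] by (intro power_mono) auto
  also have "\<dots> = exp (real n * (s - 1))" by (simp add: exp_of_nat_mult)
  finally have sn: "s ^ n \<le> exp (real n * (s - 1))" .
  have "s ^ n * H z = s ^ n * exp (- (\<beta> * (s * r) * (p z - 1))) / (s * r)"
    by (simp add: H_def nz)
  also have "\<dots> \<le> s ^ n * exp (- (\<beta> * (s * r) * (p z - 1))) / r"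
    using s r0 by (intro divide_left_mono) auto
  also have "\<dots> \<le> exp (real n * (s - 1)) * exp (- (\<beta> * (s * r) * (p z - 1))) / r"
    using sn r0 by (intro divide_right_mono mult_right_mono) auto
  also have "\<dots> = exp (real n * (s - 1) - \<beta> * (s * r) * (p z - 1)) / r"
    by (simp add: exp_diff exp_minus divide_inverse)
  also have "\<dots> \<le> exp (- (s - 1) - \<beta> * r * (p x - 1)) / r"
    using expo r0 by (intro divide_right_mono) auto
  also have "\<dots> = exp (- (s - 1)) * H x"
    by (simp add: H_def r_def exp_diff exp_minus divide_inverse mult_ac)
  finally show ?thesis by (simp add: n_def z_def)
qed

lemma barrier_comparison:
  fixes u p :: "'a::euclidean_space \<Rightarrow> real"
  assumes R: "0 < R" and p1: "1 < p1" and lip: "L-lipschitz_on S p"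
    and pS: "\<And>x. x \<in> S \<Longrightarrow> p1 \<le> p x"
    and LR: "L * R \<le> (p1 - 1) / 2" and \<beta>: "0 < \<beta>" "4 * (real DIM('a) + 1) \<le> \<beta> * R * (p1 - 1)"
    and S: "open S" "cball y R \<subseteq> S"
    and u: "\<And>x. x \<in> S \<Longrightarrow> GDERIV u x :> grad u x" "continuous_on S (grad u)"
    and nonneg: "\<And>x. x \<in> S \<Longrightarrow> 0 \<le> u x"
    and super: "p_laplacian_nonpos p S u"
    and inner: "\<And>x. norm (x - y) = R / 2 \<Longrightarrow> exp (- (\<beta> * (R / 2))) / \<beta> \<le> u x"
    and x: "R / 2 \<le> norm (x - y)" "norm (x - y) \<le> R"
  shows "barrier y R \<beta> x \<le> u x"
proof (rule ccontr)
  assume "\<not> barrier y R \<beta> x \<le> u x"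
  define w where "w = (\<lambda>x. barrier y R \<beta> x - u x)"
  define \<delta> where "\<delta> = w x / 2"
  have \<delta>: "0 < \<delta>" "\<delta> < w x" using \<open>\<not> barrier y R \<beta> x \<le> u x\<close> by (auto simp: \<delta>_def w_def)
  define A where "A = {x. R / 2 < norm (x - y) \<and> norm (x - y) < R}"
  define C where "C = {x. R / 2 \<le> norm (x - y) \<and> norm (x - y) \<le> R}"
  define K where "K = {x \<in> C. \<delta> \<le> w x}"
  have A: "open A"
    unfolding A_def by (intro open_Collect_conj open_Collect_less continuous_intros)
  have "closed C"
    unfolding C_def by (intro closed_Collect_conj closed_Collect_le continuous_intros)
  have CR: "C \<subseteq> cball y R" by (auto simp: C_def dist_norm norm_minus_commute)
  have C: "compact C" "C \<subseteq> S" "A \<subseteq> C"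
    using compact_Int_closed[OF compact_cball \<open>closed C\<close>, of y R] CR S(2)
    by (auto simp: A_def C_def inf.absorb2)
  have Cy: "x \<noteq> y" if "x \<in> C" for x using that R by (auto simp: C_def)
  define Dv where "Dv = (\<lambda>x. - ((exp (- (\<beta> * norm (x - y))) / norm (x - y)) *\<^sub>R (x - y)))"
  have w: "GDERIV w x :> Dv x - grad u x" if "x \<in> C" for x
    unfolding w_def Dv_def using that C(2) Cy \<beta>(1)
    by (intro GDERIV_diff GDERIV_barrier u(1)) auto
  have contw: "continuous_on C w" using w by (rule GDERIV_imp_continuous_on)
  have contDw: "continuous_on C (\<lambda>x. Dv x - grad u x)"
    unfolding Dv_def using Cy by (intro continuous_intros continuous_on_subset[OF u(2) C(2)]) auto
  have "closed K"
  proof -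
    have "K = C \<inter> w -` {\<delta>..}" by (auto simp: K_def)
    then show ?thesis using continuous_closed_preimage[OF contw \<open>closed C\<close>] by simp
  qed
  then have K: "compact K"
    using compact_Int_closed[OF C(1)] by (metis (no_types, lifting) K_def inf.absorb2 mem_Collect_eq subsetI)
  \<comment> \<open>On both boundary spheres \<open>w \<le> 0\<close>; subtracting \<open>\<delta>\<close> thus keeps the support of the test
    function away from them.\<close>
  have KA: "K \<subseteq> A"
  proof
    fix z assume z: "z \<in> K"
    then have zC: "z \<in> C" "\<delta> \<le> w z" by (auto simp: K_def)
    have "norm (z - y) \<noteq> R"
    proof
      assume "norm (z - y) = R"
      then have "w z \<le> 0" using nonneg[of z] zC C(2) by (auto simp: w_def barrier_def)
      then show False using zC(2) \<delta> by simp
    qed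
    moreover have "norm (z - y) \<noteq> R / 2"
    proof
      assume *: "norm (z - y) = R / 2"
      then have "barrier y R \<beta> z \<le> exp (- (\<beta> * (R / 2))) / \<beta>"
        unfolding barrier_def * using \<beta>(1) by (intro divide_right_mono) auto
      then have "w z \<le> 0" using inner[OF *] by (simp add: w_def)
      then show False using zC(2) \<delta> by simp
    qed
    ultimately show "z \<in> A" using zC(1) by (auto simp: A_def C_def)
  qed
  define \<phi> where "\<phi> = (\<lambda>x. if x \<in> A then (max 0 (w x - \<delta>))\<^sup>2 else 0)"
  define G where "G = (\<lambda>x. if x \<in> A then (2 * max 0 (w x - \<delta>)) *\<^sub>R (Dv x - grad u x) else 0)"
  have \<phi>0: "0 \<le> \<phi> z" for z by (simp add: \<phi>_def)
  have outK: "\<phi> z = 0" "G z = 0" if "z \<notin> K" for z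
    using that C(3) by (auto simp: \<phi>_def G_def K_def max_def)
  have G: "GDERIV \<phi> z :> G z" for z
  proof (cases "z \<in> A")
    case True
    then have "((\<lambda>x. w x - \<delta>) has_derivative (\<lambda>h. h \<bullet> (Dv z - grad u z))) (at z)"
      using w[of z] C(3) by (auto simp: gderiv_def intro!: derivative_eq_intros)
    from has_derivative_compose[OF this DERIV_positive_part_square[unfolded has_field_derivative_def]]
    have "((\<lambda>x. (max 0 (w x - \<delta>))\<^sup>2) has_derivative (\<lambda>h. h \<bullet> G z)) (at z)"
      by (rule has_derivative_eq_rhs) (use True in \<open>simp add: G_def fun_eq_iff\<close>)
    then show ?thesis unfolding gderiv_def
      by (rule has_derivative_transform_within_open[OF _ A True]) (simp add: \<phi>_def)
  next
    case False
    then have z: "z \<in> - K" "G z = 0" using KA by (auto simp: G_def)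
    show ?thesis unfolding gderiv_def
      by (rule has_derivative_transform_within_open[of "\<lambda>_. 0" _ _ _ "- K"])
        (use z outK \<open>closed K\<close> in auto)
  qed
  have contG: "continuous_on UNIV G"
  proof -
    have "continuous_on (A \<union> - K) G"
    proof (rule continuous_on_open_Un)
      have "continuous_on A (\<lambda>x. (2 * max 0 (w x - \<delta>)) *\<^sub>R (Dv x - grad u x))"
        by (intro continuous_intros continuous_on_subset[OF contw C(3)]
            continuous_on_subset[OF contDw C(3)])
      then show "continuous_on A G" by (rule continuous_on_eq) (simp add: G_def)
      show "continuous_on (- K) G"
        by (rule continuous_on_eq[of _ "\<lambda>_. 0"]) (auto simp: outK)
    qed (use A \<open>closed K\<close> in auto)
    moreover have "A \<union> - K = UNIV" using KA by blast
    ultimately show ?thesis by simp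
  qed
  have contp: "continuous_on S p" using lip by (rule lipschitz_on_continuous_on)
  have KS: "K \<subseteq> S" using KA C by blast
  have contF: "continuous_on S (p_flux p u)"
    unfolding p_flux_def[abs_def] using pS p1
    by (intro continuous_on_flux u(2) contp) (fastforce intro: less_le_trans)
  have weak: "0 \<le> integral UNIV (\<lambda>x. p_flux p u x \<bullet> G x)"
    using super unfolding p_laplacian_nonpos_def
    by (intro weak_inequality_C1[OF S(1) contF _ G contG \<phi>0 K KS outK(1)]) blast+
  define H0 where "H0 = (\<lambda>x. exp (- (\<beta> * norm (x - y) * (p x - 1))) / norm (x - y))"
  have "continuous_on C H0"
    unfolding H0_def using Cy by (intro continuous_intros continuous_on_subset[OF contp C(2)]) auto
  \<comment> \<open>\<open>H0\<close> is singular at \<open>y\<close>, and \<open>p\<close> is arbitrary outside \<open>S\<close>; only the values on the closed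
    annulus \<open>C\<close> matter.\<close>
  then obtain H where H: "continuous_on UNIV H" "\<And>x. x \<in> C \<Longrightarrow> H x = H0 x"
    using Tietze_unbounded[of C H0 UNIV] \<open>closed C\<close> by (metis closed_closedin subtopology_UNIV)
  have "integral UNIV (\<lambda>x. H x * \<phi> x) \<le> integral UNIV (\<lambda>x. H x * (G x \<bullet> (x - y)))"
  proof (rule dilation_inequality[OF H(1) G contG \<phi>0 K KA outK(1) A])
    fix x and s :: real
    assume *: "x \<in> A" "1 \<le> s" "y + s *\<^sub>R (x - y) \<in> A"
    then have "H x = H0 x" "H (y + s *\<^sub>R (x - y)) = H0 (y + s *\<^sub>R (x - y))"
      and "x \<in> S" "y + s *\<^sub>R (x - y) \<in> S" "R / 2 \<le> norm (x - y)" "norm (x - y) \<le> R"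
      using H(2) C(2,3) by (auto simp only: A_def mem_Collect_eq subset_iff intro: less_imp_le)
    then show "s ^ DIM('a) * H (y + s *\<^sub>R (x - y)) \<le> exp (- (s - 1)) * H x"
      using barrier_flux_dilation[OF R p1 lip pS LR \<beta>(2) *(2), of x y] by (simp only: H0_def)
  qed
  also have "\<dots> \<le> - integral UNIV (\<lambda>x. p_flux p u x \<bullet> G x)"
  proof -
    have i1: "(\<lambda>x. H x * (G x \<bullet> (x - y))) integrable_on UNIV"
    proof (rule integrable_on_bounded_support)
      show "continuous_on UNIV (\<lambda>x. H x * (G x \<bullet> (x - y)))"
        by (intro continuous_intros H(1) contG)
      show "bounded {x. H x * (G x \<bullet> (x - y)) \<noteq> 0}"
        by (rule bounded_subset[OF compact_imp_bounded[OF K]]) (use outK(2) in force)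
    qed
    have i2: "(\<lambda>x. p_flux p u x \<bullet> G x) integrable_on UNIV"
      by (intro integrable_on_bounded_support
          continuous_inner_compact_support[OF S(1) contF contG K KS outK(2)])
    have "H x * (G x \<bullet> (x - y)) \<le> - (p_flux p u x \<bullet> G x)" for x
    proof (cases "x \<in> A")
      case True
      then have xC: "x \<in> C" "x \<in> S" "x \<noteq> y" using C Cy by auto
      have q: "1 < p x" using pS[OF xC(2)] p1 by simp
      have "- (H x *\<^sub>R (x - y)) = norm (Dv x) powr (p x - 2) *\<^sub>R Dv x"
        using barrier_flux[OF xC(3), of \<beta> "p x"] H(2)[OF xC(1)] by (simp only: Dv_def H0_def)
      then have "0 \<le> (- (H x *\<^sub>R (x - y)) - p_flux p u x) \<bullet> (Dv x - grad u x)"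
        using flux_monotone[OF q, of "Dv x" "grad u x"] by (simp add: p_flux_def)
      then have "0 \<le> (2 * max 0 (w x - \<delta>)) * ((- (H x *\<^sub>R (x - y)) - p_flux p u x) \<bullet> (Dv x - grad u x))"
        by (intro mult_nonneg_nonneg) auto
      also have "\<dots> = (- (H x *\<^sub>R (x - y)) - p_flux p u x) \<bullet> G x"
        using True by (simp add: G_def)
      also have "\<dots> = - (H x * (G x \<bullet> (x - y))) - p_flux p u x \<bullet> G x"
        by (simp add: inner_diff_left inner_commute[of "G x"] algebra_simps)
      finally show ?thesis by simp
    qed (simp add: G_def)
    then have "integral UNIV (\<lambda>x. H x * (G x \<bullet> (x - y))) \<le> integral UNIV (\<lambda>x. - (p_flux p u x \<bullet> G x))"
      using integral_le[OF i1 integrable_neg[OF i2]] by blast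
    then show ?thesis by simp
  qed
  also have "\<dots> \<le> 0" using weak by simp
  also have "0 < integral UNIV (\<lambda>x. H x * \<phi> x)"
  proof (rule integral_pos_bounded_support)
    have "continuous_on UNIV \<phi>" using G by (rule GDERIV_imp_continuous_on)
    then show "continuous_on UNIV (\<lambda>x. H x * \<phi> x)" by (intro continuous_intros H(1))
    show "bounded {x. H x * \<phi> x \<noteq> 0}"
      by (rule bounded_subset[OF compact_imp_bounded[OF K]]) (use outK(1) in force)
    have Hpos: "0 < H z" if "z \<in> A" for z
      using that H(2)[of z] C(3) Cy[of z] by (auto simp: H0_def)
    show "0 \<le> H z * \<phi> z" for z
      using Hpos[of z] by (cases "z \<in> A") (auto simp: \<phi>_def)
    have "x \<in> K" using x \<delta> by (simp add: K_def C_def)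
    then have "x \<in> A" using KA by blast
    then show "0 < H x * \<phi> x" using Hpos[of x] \<delta> by (simp add: \<phi>_def)
  qed
  finally show False by simp
qed

section \<open>The strong maximum principle\<close>

text \<open>Hopf's boundary point argument: a nonnegative supersolution that is positive in a small ball has
  no zero on the boundary of the ball, as long as the closed ball lies in the domain.\<close>

lemma positive_on_sphere:
  fixes u p :: "'a::euclidean_space \<Rightarrow> real"
  assumes R: "0 < R" and p1: "1 < p1" and lip: "L-lipschitz_on S p"
    and pS: "\<And>x. x \<in> S \<Longrightarrow> p1 \<le> p x"
    and LR: "L * R \<le> (p1 - 1) / 2"
    and S: "open S" "cball y R \<subseteq> S"
    and u: "C_on 1 S u"
    and nonneg: "\<And>x. x \<in> S \<Longrightarrow> 0 \<le> u x"
    and super: "p_laplacian_nonpos p S u"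
    and pos: "\<And>x. x \<in> ball y R \<Longrightarrow> 0 < u x"
    and x0: "dist y x0 = R"
  shows "0 < u x0"
proof (rule ccontr)
  assume "\<not> 0 < u x0"
  have x0S: "x0 \<in> S" using S(2) x0 by auto
  then have ux0: "u x0 = 0" using \<open>\<not> 0 < u x0\<close> nonneg by force
  note Du = C1_gradient[OF u]
  have "continuous_on (cball y (R / 2)) u"
  proof (rule GDERIV_imp_continuous_on[of _ _ "grad u"])
    fix x assume "x \<in> cball y (R / 2)"
    then have "x \<in> cball y R" using R by auto
    then show "GDERIV u x :> grad u x" using Du(1) S(2) by blast
  qed
  then obtain xm where xm: "xm \<in> cball y (R / 2)" "\<And>x. x \<in> cball y (R / 2) \<Longrightarrow> u xm \<le> u x"
    using continuous_attains_inf[OF compact_cball] R by (metis cball_eq_empty half_gt_zero_iff less_asym)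
  have m: "0 < u xm" using xm(1) R by (intro pos) auto
  \<comment> \<open>The first bound makes the barrier at most \<open>1 / \<beta> \<le> u\<close> on the inner sphere, the second makes
    it a strict subsolution.\<close>
  define \<beta> where "\<beta> = max (1 / u xm) (4 * (real DIM('a) + 1) / (R * (p1 - 1)))"
  have "0 < 1 / u xm" using m by simp
  then have \<beta>0: "0 < \<beta>" by (simp add: \<beta>_def less_max_iff_disj)
  have "4 * (real DIM('a) + 1) / (R * (p1 - 1)) \<le> \<beta>" by (simp add: \<beta>_def)
  then have \<beta>1: "4 * (real DIM('a) + 1) \<le> \<beta> * R * (p1 - 1)"
    using R p1 by (simp add: pos_divide_le_eq mult.assoc)
  have \<beta>2: "1 / \<beta> \<le> u xm"
  proof -
    have "1 / u xm \<le> \<beta>" by (simp add: \<beta>_def)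
    then show ?thesis using m \<beta>0 by (simp add: field_simps)
  qed
  have below: "barrier y R \<beta> x \<le> u x" if "R / 2 \<le> norm (x - y)" "norm (x - y) \<le> R" for x
  proof (rule barrier_comparison[OF R p1 lip pS LR \<beta>0 \<beta>1 S Du nonneg super _ that])
    fix x assume "norm (x - y) = R / 2"
    then have "x \<in> cball y (R / 2)" by (simp add: dist_norm norm_minus_commute)
    then have "u xm \<le> u x" by (rule xm(2))
    moreover have "exp (- (\<beta> * (R / 2))) / \<beta> \<le> 1 / \<beta>"
      using \<beta>0 R by (intro divide_right_mono) auto
    ultimately show "exp (- (\<beta> * (R / 2))) / \<beta> \<le> u x" using \<beta>2 by linarith
  qed
  have grad0: "grad u x0 = 0"
  proof -
    have "(u has_derivative (\<lambda>h. h \<bullet> grad u x0)) (at x0)"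
      using Du(1)[OF x0S] by (simp add: gderiv_def)
    moreover obtain e where "0 < e" "ball x0 e \<subseteq> S"
      using S(1) x0S openE by blast
    then have "\<forall>\<^sub>F x in at x0. u x0 \<le> u x"
      unfolding eventually_at using ux0 nonneg
      by (intro exI[of _ e]) (auto simp: dist_commute subset_iff)
    ultimately have "(\<lambda>h. h \<bullet> grad u x0) = (\<lambda>h. 0)"
      by (rule has_derivative_local_min)
    then have "grad u x0 \<bullet> grad u x0 = 0" by meson
    then show ?thesis by simp
  qed
  have nx: "norm (x0 - y) = R" using x0 by (simp add: dist_norm norm_minus_commute)
  \<comment> \<open>The difference of \<open>u\<close> and the barrier along the segment from \<open>x0\<close> to \<open>y\<close>.\<close>
  define g where "g = (\<lambda>t. u (x0 + t *\<^sub>R (y - x0)) - (exp (- (\<beta> * ((1 - t) * R))) - exp (- (\<beta> * R))) / \<beta>)"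
  have "((\<lambda>t. u (x0 + t *\<^sub>R (y - x0))) has_real_derivative 0) (at 0)"
  proof -
    have "((\<lambda>t. x0 + t *\<^sub>R (y - x0)) has_derivative (\<lambda>h. h *\<^sub>R (y - x0))) (at 0)"
      by (auto intro!: derivative_eq_intros)
    moreover have "(u has_derivative (\<lambda>h. h \<bullet> grad u x0)) (at (x0 + 0 *\<^sub>R (y - x0)))"
      using Du(1)[OF x0S] by (simp add: gderiv_def)
    ultimately have "((\<lambda>t. u (x0 + t *\<^sub>R (y - x0))) has_derivative
        (\<lambda>h. (h *\<^sub>R (y - x0)) \<bullet> grad u x0)) (at 0)"
      by (rule has_derivative_compose)
    then show ?thesis unfolding has_field_derivative_def
      by (rule has_derivative_eq_rhs) (simp add: grad0 fun_eq_iff)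
  qed
  moreover have "((\<lambda>t. (exp (- (\<beta> * ((1 - t) * R))) - exp (- (\<beta> * R))) / \<beta>) has_real_derivative
      R * exp (- (\<beta> * R))) (at 0)"
    using \<beta>0 by (auto intro!: derivative_eq_intros simp: field_simps)
  ultimately have "(g has_real_derivative 0 - R * exp (- (\<beta> * R))) (at 0)"
    unfolding g_def by (rule DERIV_diff)
  from has_real_derivative_neg_dec_right[OF this] R obtain d where
    d: "0 < d" "\<And>h. 0 < h \<Longrightarrow> h < d \<Longrightarrow> g h < g 0" by auto
  define h where "h = min (d / 2) (1 / 2)"
  have h: "0 < h" "h < d" "h \<le> 1 / 2" using d(1) by (auto simp: h_def)
  have "g 0 = 0" by (simp add: g_def ux0)
  moreover have "0 \<le> g h"
  proof -
    have "x0 + h *\<^sub>R (y - x0) - y = (1 - h) *\<^sub>R (x0 - y)" by (simp add: algebra_simps)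
    then have nh: "norm (x0 + h *\<^sub>R (y - x0) - y) = (1 - h) * R" using h nx by simp
    have "1 / 2 * R \<le> (1 - h) * R" "(1 - h) * R \<le> 1 * R"
      using h R by (intro mult_right_mono; simp)+
    then have "barrier y R \<beta> (x0 + h *\<^sub>R (y - x0)) \<le> u (x0 + h *\<^sub>R (y - x0))"
      using below nh by auto
    then show ?thesis by (simp add: g_def barrier_def nh)
  qed
  ultimately show False using d(2)[OF h(1,2)] by simp
qed

theorem theorem4p1:
  fixes \<Omega> :: "'a::euclidean_space set" and p u :: "'a \<Rightarrow> real" and p1 p2 L :: real
  assumes "open \<Omega>" and "connected \<Omega>"
    and "1 < p1" and "\<And>x. x \<in> \<Omega> \<Longrightarrow> p1 \<le> p x \<and> p x \<le> p2"
    and "L-lipschitz_on \<Omega> p"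
    and "C_on 1 \<Omega> u"
    and "\<And>x. x \<in> \<Omega> \<Longrightarrow> 0 \<le> u x"
    and "p_laplacian_nonpos p \<Omega> u"
  shows "(\<forall>x\<in>\<Omega>. u x = 0) \<or> (\<forall>x\<in>\<Omega>. 0 < u x)"
proof (rule ccontr)
  assume "\<not> ?thesis"
  then obtain a b where ab: "a \<in> \<Omega>" "u a \<noteq> 0" "b \<in> \<Omega>" "u b = 0"
    using assms(7) by (metis order_le_less)
  have contu: "continuous_on \<Omega> u"
    using C1_gradient(1)[OF assms(6)] by (rule GDERIV_imp_continuous_on)
  define P Z where "P = {x \<in> \<Omega>. u x \<noteq> 0}" and "Z = {x \<in> \<Omega>. u x = 0}"
  have "open P"
  proof -
    have "P = \<Omega> \<inter> u -` (- {0})" by (auto simp: P_def)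
    then show ?thesis
      using continuous_open_preimage[OF contu assms(1) open_Compl[OF closed_singleton]] by simp
  qed
  have "\<not> open Z"
  proof
    assume "open Z"
    moreover have "\<Omega> \<subseteq> P \<union> Z" "P \<inter> Z \<inter> \<Omega> = {}" "P \<inter> \<Omega> \<noteq> {}" "Z \<inter> \<Omega> \<noteq> {}"
      using ab by (auto simp: P_def Z_def)
    ultimately show False
      using assms(2) \<open>open P\<close> unfolding connected_def by blast
  qed
  then obtain z where z: "z \<in> Z" "\<And>e. 0 < e \<Longrightarrow> \<not> ball z e \<subseteq> Z"
    unfolding open_contains_ball by blast
  obtain e where e: "0 < e" "ball z e \<subseteq> \<Omega>"
    using assms(1) z(1) by (auto simp: Z_def open_contains_ball)
  have L0: "0 \<le> L" using assms(5) by (simp add: lipschitz_on_def)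
  \<comment> \<open>Every ball of radius less than \<open>r\<close> is small enough for the barrier.\<close>
  define r where "r = min (e / 4) ((p1 - 1) / (2 * (L + 1)))"
  have r: "0 < r" "4 * r \<le> e" using e(1) assms(3) L0 by (auto simp: r_def)
  have Lr: "L * r \<le> (p1 - 1) / 2"
  proof -
    have "r \<le> (p1 - 1) / (2 * (L + 1))" by (simp add: r_def)
    then have "r * (2 * (L + 1)) \<le> p1 - 1" using L0 by (simp add: pos_le_divide_eq)
    then show ?thesis using r(1) by (simp add: algebra_simps)
  qed
  obtain y where y: "dist z y < r" "y \<notin> Z"
    using z(2)[OF r(1)] mem_ball by blast
  have near: "x \<in> \<Omega>" if "dist z x \<le> 2 * r" for x using that e r by auto
  have "continuous_on (cball z (2 * r)) u"
    using contu by (rule continuous_on_subset) (use near in auto)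
  then have "closed (cball z (2 * r) \<inter> u -` {0})"
    by (intro continuous_closed_preimage) auto
  \<comment> \<open>A nearest zero \<open>x0\<close> to \<open>y\<close>: zeros outside \<open>cball z (2 * r)\<close> are farther from \<open>y\<close> than \<open>z\<close> is.\<close>
  define N where "N = cball z (2 * r) \<inter> u -` {0}"
  have "closed N" unfolding N_def by fact
  moreover have zN: "z \<in> N" using z(1) r by (auto simp: N_def Z_def)
  ultimately obtain x0 where x0: "x0 \<in> N" "\<And>x. x \<in> N \<Longrightarrow> dist y x0 \<le> dist y x"
    using distance_attains_inf[of N y] by blast
  define R where "R = dist y x0"
  have y\<Omega>: "y \<in> \<Omega>" "u y \<noteq> 0" using y near[of y] r by (auto simp: Z_def)
  have R: "0 < R" using x0(1) y\<Omega> by (auto simp: R_def N_def)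
  have "R \<le> dist y z" using x0(2)[OF zN] by (simp add: R_def)
  then have Rr: "R < r" using y(1) by (simp add: dist_commute)
  have inside: "dist z x \<le> 2 * r" if "dist y x \<le> R" for x
    using dist_triangle[of z x y] that y(1) Rr by simp
  have "0 < u x0"
  proof (rule positive_on_sphere[OF R assms(3,5) _ _ assms(1) _ assms(6,7,8)])
    show "p1 \<le> p x" if "x \<in> \<Omega>" for x using assms(4) that by blast
    have "L * R \<le> L * r" using L0 Rr by (intro mult_left_mono) auto
    then show "L * R \<le> (p1 - 1) / 2" using Lr by linarith
    show "cball y R \<subseteq> \<Omega>" using inside near by auto
    show "0 < u x" if "x \<in> ball y R" for x
    proof -
      have 1: "dist z x \<le> 2 * r" using inside[of x] that by simp
      have "u x \<noteq> 0"
      proof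
        assume "u x = 0"
        then have "x \<in> N" using 1 by (simp add: N_def)
        from x0(2)[OF this] show False using that by (simp add: R_def)
      qed
      then show ?thesis using assms(7)[OF near[OF 1]] by simp
    qed
    show "dist y x0 = R" by (simp add: R_def)
  qed
  then show False using x0(1) by (simp add: N_def)
qed

end
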